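(* Let $X$ be a connected open subset of $\mathbb{C}^N$ with closure $\overline X$ in $\mathbb{C}^N$, and assume that the boundary $\partial X=\overline X\setminus X$ is $\mathcal{C}^0$ smooth. Let $n\in\mathbb{N}^*$ and let $A:\overline X\to\mathrm{Mat}(n\times n,\mathbb{C})$ be continuous on $\overline X$ and holomorphic in $X$. Denote by $\mathrm{Jst}\,A\subseteq\overline X$ the set of Jordan stable points of $A$. Then $X\setminus\mathrm{Jst}\,A$ is a nowhere dense analytic subset of $X$, $\overline X\setminus\mathrm{Jst}\,A$ is nowhere dense in $\overline X$, and, if $\mathrm{Jst}\,A\neq\overline X$, then there exist finitely many functions $h_1,\ldots,h_\ell:\overline X\to\mathbb{C}$, which are continuous on $\overline X$ and holomorphic in $X$, such that \[ \overline X\setminus\mathrm{Jst}\,A=\{\zeta\in\overline X: h_1(\zeta)=\ldots=h_\ell(\zeta)=0\} \] and \[ |h_j(\zeta)|\le (2n)^{2n^4}\,\|A(\zeta)\|^{2n^4}\quad\text{for all }\zeta\in\overline X\text{ and }1\le j\le\ell . \]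
   Context: $\mathbb{N}^*=\{1,2,\ldots\}$; $\mathrm{Mat}(n\times n,\mathbb{C})$ is the space of complex $n\times n$ matrices; $\|\Phi\|$ is the operator norm of $\Phi$ with respect to the Euclidean norm on $\mathbb{C}^n$. $\partial X$ is $\mathcal{C}^0$ smooth means: for each $\xi\in\partial X$ there is a neighborhood of $\xi$ in $\overline X$ which is homeomorphic to a set of the form $U\cap\{(x_1,\ldots,x_{2N})\in\mathbb{R}^{2N}: x_1\ge 0\}$, where $U$ is an open subset of $\mathbb{R}^{2N}$. A subset $Y\subseteq X$ is a (closed) analytic subset of $X$ if each $\xi\in X$ has a neighborhood $U\subseteq X$ and finitely many holomorphic functions on $U$ whose common zero set is $Y\cap U$. Eigenvalues are listed without counting multiplicities. For $\Phi\in\mathrm{Mat}(n\times n,\mathbb{C})$ and $\ell\in\mathbb{N}^*$, let $\vartheta_\ell(\Phi,\bullet)$ be the total number (over all eigenvalues) of Jordan blocks of size $\ell$ in the Jordan normal forms of $\Phi$. A point $\xi\in\overline X$ is a splitting point of the eigenvalues of $A$ if for each neighborhood $U$ of $\xi$ in $\overline X$ there is $\zeta\in U$ such that $A(\zeta)$ has more (distinct) eigenvalues than $A(\xi)$. A point $\xi\in\overline X$ is Jordan stable for $A$ if $\xi$ is not a splitting point of the eigenvalues of $A$ and there is a neighborhood $V$ of $\xi$ in $\overline X$ such that for each $1\le\ell\le n$ the function $V\ni\zeta\mapsto\vartheta_\ell(A(\zeta),\bullet)$ is constant. *)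

theory Defs
  imports
    "HOL-Analysis.Analysis"
    "Jordan_Normal_Form.Jordan_Normal_Form_Existence"
    "Jordan_Normal_Form.Jordan_Normal_Form_Uniqueness"
    "Jordan_Normal_Form.Spectral_Radius"
begin

definition nbhd_in :: "'a::topological_space set \<Rightarrow> 'a \<Rightarrow> 'a set \<Rightarrow> bool" where
  "nbhd_in S \<xi> V \<longleftrightarrow>
     V \<subseteq> S \<and> (\<exists>W. openin (top_of_set S) W \<and> \<xi> \<in> W \<and> W \<subseteq> V)"

definition nowhere_dense_in :: "'a::topological_space set \<Rightarrow> 'a set \<Rightarrow> bool" where
  "nowhere_dense_in S Y \<longleftrightarrow>
     Y \<subseteq> S \<and> (top_of_set S) interior_of ((top_of_set S) closure_of Y) = {}"

text \<open>The index type \<^typ>\<open>'N bit0\<close> has exactly twice as many elements as \<^typ>\<open>'N\<close>, so that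
  \<^typ>\<open>real ^ 'N bit0\<close> is the real Euclidean space of dimension $2N$. Its element \<open>0\<close> plays the
  role of the first index.\<close>

definition C0_smooth_boundary :: "(complex ^ 'N) set \<Rightarrow> bool" where
  "C0_smooth_boundary X \<longleftrightarrow>
     (\<forall>\<xi> \<in> closure X - X. \<exists>V. nbhd_in (closure X) \<xi> V \<and>
        (\<exists>U :: (real ^ 'N bit0) set. open U \<and>
           V homeomorphic (U \<inter> {x. 0 \<le> vec_nth x 0})))"

text \<open>Holomorphy in several variables on an open set: at each point the Frechet derivative exists
  and is complex linear.\<close>

definition holomorphic_sev_on :: "(complex ^ 'N \<Rightarrow> complex) \<Rightarrow> (complex ^ 'N) set \<Rightarrow> bool" where
  "holomorphic_sev_on f U \<longleftrightarrow>
     (\<forall>z \<in> U. \<exists>D. (f has_derivative D) (at z) \<and> (\<forall>c v. D (c *s v) = c * D v))"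

definition analytic_subset :: "(complex ^ 'N) set \<Rightarrow> (complex ^ 'N) set \<Rightarrow> bool" where
  "analytic_subset X Y \<longleftrightarrow>
     Y \<subseteq> X \<and>
     (\<forall>\<xi> \<in> X. \<exists>U. open U \<and> \<xi> \<in> U \<and> U \<subseteq> X \<and>
        (\<exists>(m::nat) f. (\<forall>i<m. holomorphic_sev_on (f i) U) \<and>
           Y \<inter> U = {z \<in> U. \<forall>i<m. f i z = 0}))"

text \<open>For the matrices of \<^theory>\<open>Jordan_Normal_Form.Matrix\<close>, which carry no topology, continuity
  and holomorphy are those of the $n^2$ entries.\<close>

definition mat_continuous_on :: "nat \<Rightarrow> 'a::topological_space set \<Rightarrow> ('a \<Rightarrow> complex mat) \<Rightarrow> bool"
  where
  "mat_continuous_on n S A \<longleftrightarrow>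
     (\<forall>i<n. \<forall>j<n. continuous_on S (\<lambda>\<zeta>. index_mat (A \<zeta>) (i, j)))"

definition mat_holomorphic_on ::
  "nat \<Rightarrow> (complex ^ 'N) set \<Rightarrow> (complex ^ 'N \<Rightarrow> complex mat) \<Rightarrow> bool" where
  "mat_holomorphic_on n U A \<longleftrightarrow>
     (\<forall>i<n. \<forall>j<n. holomorphic_sev_on (\<lambda>\<zeta>. index_mat (A \<zeta>) (i, j)) U)"

definition eucl_norm :: "complex Matrix.vec \<Rightarrow> real" where
  "eucl_norm v = L2_set (\<lambda>i. cmod (vec_index v i)) {..<dim_vec v}"

definition mat_op_norm :: "complex mat \<Rightarrow> real" where
  "mat_op_norm \<Phi> =
     (SUP v \<in> {v \<in> carrier_vec (dim_col \<Phi>). eucl_norm v \<le> 1}. eucl_norm (\<Phi> *\<^sub>v v))"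

text \<open>The entries of a list \<open>n_as\<close> with \<^prop>\<open>jordan_nf \<Phi> n_as\<close> are the pairs (size, eigenvalue)
  of the Jordan blocks. The choice of the list is irrelevant by the lemma below.\<close>

definition jordan_block_count :: "nat \<Rightarrow> complex mat \<Rightarrow> nat" where
  "jordan_block_count l \<Phi> =
     length (filter (\<lambda>(k, ev). k = l) (SOME n_as. jordan_nf \<Phi> n_as))"

lemma jordan_block_count_eq:
  assumes "jordan_nf \<Phi> n_as"
  shows "jordan_block_count l \<Phi> = length (filter (\<lambda>(k, ev). k = l) n_as)"
proof -
  define m_bs where "m_bs = (SOME n_as. jordan_nf \<Phi> n_as)"
  have m: "jordan_nf \<Phi> m_bs"
    unfolding m_bs_def using assms by (rule someI)
  have count_0: "count (mset xs) (0, ev) = 0" if "jordan_nf \<Phi> xs" for xs ev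
    using that by (force simp: jordan_nf_def count_mset_0_iff)
  have cnt: "count (mset xs) p = length (filter ((=) p) xs)" for xs :: "(nat \<times> complex) list" and p
    by (simp add: count_mset count_list_eq_length_filter)
  have "mset n_as = mset m_bs"
  proof (rule multiset_eqI)
    fix p :: "nat \<times> complex"
    obtain k ev where p: "p = (k, ev)" by force
    show "count (mset n_as) p = count (mset m_bs) p"
    proof (cases "k = 0")
      case True
      then show ?thesis using p count_0[OF assms] count_0[OF m] by metis
    next
      case False
      then show ?thesis
        unfolding p cnt by (metis compute_nr_of_jordan_blocks assms m)
    qed
  qed
  then have "mset (filter P n_as) = mset (filter P m_bs)" for P
    by simp
  then have "length (filter P n_as) = length (filter P m_bs)" for P
    using mset_eq_length by blast
  then show ?thesis
    unfolding jordan_block_count_def m_bs_def by simp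
qed

definition splitting_point ::
  "(complex ^ 'N) set \<Rightarrow> (complex ^ 'N \<Rightarrow> complex mat) \<Rightarrow> complex ^ 'N \<Rightarrow> bool" where
  "splitting_point X A \<xi> \<longleftrightarrow>
     \<xi> \<in> closure X \<and>
     (\<forall>U. nbhd_in (closure X) \<xi> U \<longrightarrow>
        (\<exists>\<zeta>\<in>U. card (spectrum (A \<zeta>)) > card (spectrum (A \<xi>))))"

definition Jst ::
  "nat \<Rightarrow> (complex ^ 'N) set \<Rightarrow> (complex ^ 'N \<Rightarrow> complex mat) \<Rightarrow> (complex ^ 'N) set" where
  "Jst n X A = {\<xi> \<in> closure X.
     \<not> splitting_point X A \<xi> \<and>
     (\<exists>V. nbhd_in (closure X) \<xi> V \<and>
        (\<forall>l \<in> {1..n}. (\<lambda>\<zeta>. jordan_block_count l (A \<zeta>)) constant_on V))}"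

end

theory Submission
  imports Defs "HOL-Complex_Analysis.Conformal_Mappings"
begin

text \<open>Write $c(\<Phi>)$ for the number of distinct eigenvalues of a matrix $\<Phi>$, and let $M$ be the maximum
of $c(A(\<zeta>))$ over the closure of $X$. The idea is to recognise Jordan stability by the
non-vanishing of finitely many polynomials in the entries of $A$.

The Hankel determinant $D = det (tr \<Phi>^{i+j})_{i,j<M}$ is the product of the multiplicities of the
eigenvalues with the square of their Vandermonde determinant if $c(\<Phi>) = M$, and it is zero
if $c(\<Phi>) < M$. So $D(A(\<zeta>)) \<noteq> 0$ says that $c(A(\<zeta>)) = M$ (lemma \<open>hankel_disc_nonzero_iff\<close>).

Let $p(t)$ be the product of $t - \<lambda>$ over the distinct eigenvalues. The kernel of $p(\<Phi>)^k$ has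
dimension equal to the sum of $min(k, b)$ over all Jordan blocks, $b$ being the block size, so the
ranks of $p(\<Phi>)^k$ for $1 \<le> k \<le> n$ and the numbers of Jordan blocks of each size determine each other.
The coefficients of $p$ are not polynomials in the entries of $\<Phi>$, but those of $D p(t)^k$ are: replacing
the traces in $D$ by $tr ((t - \<Phi>)^k \<Phi>^{i+j})$ gives exactly $D p(t)^k$
(lemma \<open>hankel_factorization\<close>). Substituting $\<Phi>$ for $t$ gives a matrix \<open>hankel_mat\<close> whose entries are
homogeneous polynomials in those of $\<Phi>$, of degree $M(M-1) + kM$, and which has the rank of
$p(\<Phi>)^k$ wherever $D \<noteq> 0$.

Let $r_k$ be the largest rank of this matrix on the set where $D \<noteq> 0$, and call a point generic if there
$D \<noteq> 0$ and all these ranks equal $r_k$. Maximality of a rank is the non-vanishing of some minor of size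
$r_k$, so genericity is the non-vanishing of some product of $D$ with one $r_k$-minor for each $k$. These
products are continuous on the closure and holomorphic in $X$; hence the generic points form a relatively
open set. It is dense because, by the identity theorem on the connected set $X$, a product of such
functions vanishes on an open part only if one of the factors vanishes everywhere. A generic point is
Jordan stable, as its generic neighbours have the same block counts. Conversely a Jordan stable point has
generic points in every neighbourhood, and shares with them the number of eigenvalues and the block counts,
so it is generic (theorem \<open>Jst_eq_generic\<close>).

The products have some degree $d \<le> 2n^4$, while the estimate demands homogeneity of degree exactly
$2n^4$. The difference is made up by a power of an off-diagonal entry or of a difference of
diagonal entries. These all vanish together only where $A(\<zeta>)$ is scalar, and a scalar value at a generic point
forces every point to be generic, so the zero set is not enlarged unless it was empty.\<close>

section \<open>Minors and the dimension of the kernel\<close>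

text \<open>The rows and columns are selected by functions rather than by index sets: then neither an
enumeration of a set nor a condition on its cardinality is needed, and a selection that repeats an
index just gives the value zero.\<close>

definition minor :: "'a::comm_ring_1 mat \<Rightarrow> nat \<Rightarrow> (nat \<Rightarrow> nat) \<Rightarrow> (nat \<Rightarrow> nat) \<Rightarrow> 'a" where
  "minor Q r f g = Determinant.det (Matrix.mat r r (\<lambda>(i, j). Q $$ (f i, g j)))"

text \<open>By multilinearity in the rows, the determinant of $U W$ is a linear combination of the
determinants of matrices whose rows are rows of $W$; this is the part of the Cauchy-Binet formula
that is needed to pass from a product of rectangular matrices to a minor of one factor.\<close>

lemma det_rect_mult_nonzero:
  fixes U W :: "'a::comm_ring_1 mat"
  assumes U: "U \<in> carrier_mat r n" and W: "W \<in> carrier_mat n r"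
    and nz: "Determinant.det (U * W) \<noteq> 0"
  obtains f where "\<And>i. i < r \<Longrightarrow> f i < n"
    and "Determinant.det (Matrix.mat r r (\<lambda>(i, j). W $$ (f i, j))) \<noteq> 0"
proof -
  let ?a = "\<lambda>i l. (U $$ (i, l)) \<cdot>\<^sub>v Matrix.row W l"
  have a: "?a \<in> {0..<r} \<rightarrow> {0..<n} \<rightarrow> carrier_vec r"
    using W by auto
  have rowW: "Matrix.row W l \<in> carrier_vec r" for l
    using W by auto
  have UW: "U * W = mat\<^sub>r r r (\<lambda>i. finsum_vec TYPE('a) r (?a i) {0..<n})"
  proof (rule eq_matI)
    fix i j assume ij: "i < dim_row (mat\<^sub>r r r (\<lambda>i. finsum_vec TYPE('a) r (?a i) {0..<n}))"
      "j < dim_col (mat\<^sub>r r r (\<lambda>i. finsum_vec TYPE('a) r (?a i) {0..<n}))"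
    then have ij: "i < r" "j < r" by auto
    have "finsum_vec TYPE('a) r (?a i) {0..<n} \<in> carrier_vec r"
      by (rule finsum_vec_closed) (use W in auto)
    then have "mat\<^sub>r r r (\<lambda>i. finsum_vec TYPE('a) r (?a i) {0..<n}) $$ (i, j)
        = vec_index (finsum_vec TYPE('a) r (?a i) {0..<n}) j"
      using ij by simp
    also have "\<dots> = (\<Sum>l = 0..<n. vec_index (?a i l) j)"
      by (rule index_finsum_vec) (use W ij in auto)
    also have "\<dots> = (\<Sum>l = 0..<n. U $$ (i, l) * W $$ (l, j))"
      using W ij by (intro sum.cong) auto
    also have "\<dots> = (U * W) $$ (i, j)"
      using U W ij by (simp add: scalar_prod_def)
    finally show "(U * W) $$ (i, j) = mat\<^sub>r r r (\<lambda>i. finsum_vec TYPE('a) r (?a i) {0..<n}) $$ (i, j)"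
      by simp
  qed (use U W in auto)
  define F where "F = {f. (\<forall>i\<in>{0..<r}. f i \<in> {0..<n}) \<and> (\<forall>i. i \<notin> {0..<r} \<longrightarrow> f i = i)}"
  define D where "D f = Determinant.det (mat\<^sub>r r r (\<lambda>i. ?a i (f i)))" for f
  have "Determinant.det (U * W) = (\<Sum>f\<in>F. D f)"
    unfolding UW F_def D_def by (rule det_linear_rows_sum[OF finite_atLeastLessThan a])
  with nz have "(\<Sum>f\<in>F. D f) \<noteq> 0" by simp
  then obtain f where fF: "f \<in> F" and Df: "D f \<noteq> 0"
    by (rule sum.not_neutral_contains_not_neutral)
  from fF have f: "\<forall>i\<in>{0..<r}. f i \<in> {0..<n}" unfolding F_def by blast
  note d = Df[unfolded D_def]
  have "Determinant.det (mat\<^sub>r r r (\<lambda>i. ?a i (f i)))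
      = prod (\<lambda>i. U $$ (i, f i)) {0..<r} * Determinant.det (mat\<^sub>r r r (\<lambda>i. Matrix.row W (f i)))"
    by (rule det_rows_mul) (use rowW in auto)
  with d have "Determinant.det (mat\<^sub>r r r (\<lambda>i. Matrix.row W (f i))) \<noteq> 0"
    by (metis mult_zero_right)
  moreover have "mat\<^sub>r r r (\<lambda>i. Matrix.row W (f i)) = Matrix.mat r r (\<lambda>(i, j). W $$ (f i, j))"
    using f W by (intro eq_matI) auto
  ultimately show ?thesis using that[of f] f by auto
qed

text \<open>The reduced echelon form exhibits the rank as the number of nonzero rows, and is related to
the matrix by invertible factors on the left.\<close>

lemma echelon_decomposition:
  fixes Q :: "'a::field mat"
  assumes Q: "Q \<in> carrier_mat n n"
  obtains E P R p where "E = P * Q" "Q = R * E" "E \<in> carrier_mat n n" "P \<in> carrier_mat n n"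
    "R \<in> carrier_mat n n" "pivot_fun E p n"
    "kernel_dim Q = n - card {i. i < n \<and> Matrix.row E i \<noteq> 0\<^sub>v n}"
proof -
  define E where "E = gauss_jordan_single Q"
  note gj = gauss_jordan_single[OF Q E_def[symmetric]]
  from gj(4) obtain P R where PR: "E = P * Q" "P \<in> carrier_mat n n" "R \<in> carrier_mat n n"
    "P * R = 1\<^sub>m n" "R * P = 1\<^sub>m n" by auto
  have "R * E = (R * P) * Q" unfolding PR(1)
    by (rule assoc_mult_mat[symmetric]) (use PR Q in auto)
  then have QE: "Q = R * E" using PR Q by simp
  from gj(3) obtain p where p: "pivot_fun E p (dim_col E)"
    unfolding row_echelon_form_def by auto
  have "mat_kernel E = mat_kernel Q"
    unfolding PR(1) by (rule mat_kernel_mult_eq) (use PR Q in auto)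
  then have "kernel_dim Q = n - card {i. i < n \<and> Matrix.row E i \<noteq> 0\<^sub>v n}"
    using find_base_vectors(6)[OF gj(3,2)] Q unfolding kernel_dim_def by auto
  then show ?thesis using that[OF PR(1) QE gj(2) PR(2,3)] p gj(2) by auto
qed

text \<open>Together with the next lemma: the rank is the largest size of a nonzero minor. Here the pivot
columns of the echelon form $P Q$ give an identity matrix $U W$, where $U$ consists of rows of $P$ and
$W$ of columns of $Q$; some rows of $W$ then have nonzero determinant.\<close>

lemma rank_minor_exists:
  fixes Q :: "'a::field mat"
  assumes Q: "Q \<in> carrier_mat n n" and r: "r = n - kernel_dim Q"
  obtains f g where "\<And>i. i < r \<Longrightarrow> f i < n" "\<And>i. i < r \<Longrightarrow> g i < n" "minor Q r f g \<noteq> 0"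
proof -
  from echelon_decomposition[OF Q] obtain E P R p where
    E: "E = P * Q" "Q = R * E" "E \<in> carrier_mat n n" "P \<in> carrier_mat n n"
    "R \<in> carrier_mat n n" and p: "pivot_fun E p n"
    and kd: "kernel_dim Q = n - card {i. i < n \<and> Matrix.row E i \<noteq> 0\<^sub>v n}" .
  define S where "S = {i. i < n \<and> Matrix.row E i \<noteq> 0\<^sub>v n}"
  have finS: "finite S" unfolding S_def by auto
  have "S \<subseteq> {0..<n}" unfolding S_def by auto
  then have "card S \<le> n" using card_mono[of "{0..<n}" S] by auto
  with r kd have cS: "card S = r" unfolding S_def by auto
  from ex_bij_betw_nat_finite[OF finS] obtain s where s: "bij_betw s {0..<r} S"
    unfolding cS by auto
  have sS: "s i \<in> S" if "i < r" for i using s that by (auto simp: bij_betw_def)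
  have sn: "s i < n" if "i < r" for i using sS[OF that] S_def by auto
  have dimE: "dim_row E = n" using E by auto
  note piv = pivot_funD[OF dimE p]
  have pn: "p (s i) < n" if "i < r" for i
  proof (rule ccontr)
    assume "\<not> p (s i) < n"
    with piv(1)[OF sn[OF that]] have "p (s i) = n" by auto
    with piv(2)[OF sn[OF that]] have "Matrix.row E (s i) = 0\<^sub>v n"
      using E(3) sn[OF that] by (intro eq_vecI) auto
    with sS[OF that] show False unfolding S_def by auto
  qed
  have Epiv: "E $$ (s i, p (s j)) = (if i = j then 1 else 0)" if "i < r" "j < r" for i j
  proof (cases "i = j")
    case True
    then show ?thesis using piv(4)[OF sn[OF that(1)]] pn that by auto
  next
    case False
    then have "s i \<noteq> s j" using s that by (auto simp: bij_betw_def inj_on_def)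
    then show ?thesis using piv(5)[OF sn[OF that(2)] pn[OF that(2)] sn[OF that(1)]] False by auto
  qed
  define U where "U = Matrix.mat r n (\<lambda>(i, l). P $$ (s i, l))"
  define W where "W = Matrix.mat n r (\<lambda>(l, j). Q $$ (l, p (s j)))"
  have "U * W = 1\<^sub>m r"
  proof (rule eq_matI)
    fix i j assume "i < dim_row (1\<^sub>m r)" "j < dim_col (1\<^sub>m r)"
    then have ij: "i < r" "j < r" by auto
    have "(U * W) $$ (i, j) = (P * Q) $$ (s i, p (s j))"
      using ij sn pn E(4) Q unfolding U_def W_def by (simp add: scalar_prod_def)
    then show "(U * W) $$ (i, j) = 1\<^sub>m r $$ (i, j)"
      using Epiv[OF ij] ij unfolding E(1)[symmetric] by simp
  qed (auto simp: U_def W_def)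
  then have "Determinant.det (U * W) \<noteq> 0" by simp
  then obtain f where f: "\<And>i. i < r \<Longrightarrow> f i < n"
    "Determinant.det (Matrix.mat r r (\<lambda>(i, j). W $$ (f i, j))) \<noteq> 0"
    using det_rect_mult_nonzero[of U r n W] unfolding U_def W_def by auto
  have "Matrix.mat r r (\<lambda>(i, j). W $$ (f i, j)) = Matrix.mat r r (\<lambda>(i, j). Q $$ (f i, p (s j)))"
    using f(1) unfolding W_def by (intro eq_matI) auto
  with f pn show ?thesis using that[of f "\<lambda>j. p (s j)"] unfolding minor_def by auto
qed

text \<open>A nonzero minor of $Q = R E$ yields a nonzero minor of the echelon form $E$ of the same size, and its
rows must be distinct and nonzero.\<close>

lemma minor_size_le_rank:
  fixes Q :: "'a::field mat"
  assumes Q: "Q \<in> carrier_mat n n"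
    and f: "\<And>i. i < r \<Longrightarrow> f i < n" and g: "\<And>i. i < r \<Longrightarrow> g i < n"
    and nz: "minor Q r f g \<noteq> 0"
  shows "r \<le> n - kernel_dim Q"
proof -
  from echelon_decomposition[OF Q] obtain E P R p where
    E: "E = P * Q" "Q = R * E" "E \<in> carrier_mat n n" "P \<in> carrier_mat n n"
    "R \<in> carrier_mat n n" and p: "pivot_fun E p n"
    and kd: "kernel_dim Q = n - card {i. i < n \<and> Matrix.row E i \<noteq> 0\<^sub>v n}" .
  define S where "S = {i. i < n \<and> Matrix.row E i \<noteq> 0\<^sub>v n}"
  have finS: "finite S" unfolding S_def by auto
  define U where "U = Matrix.mat r n (\<lambda>(i, l). R $$ (f i, l))"
  define W where "W = Matrix.mat n r (\<lambda>(l, j). E $$ (l, g j))"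
  have "Matrix.mat r r (\<lambda>(i, j). Q $$ (f i, g j)) = U * W"
  proof (rule eq_matI)
    fix i j assume "i < dim_row (U * W)" "j < dim_col (U * W)"
    then have ij: "i < r" "j < r" by (auto simp: U_def W_def)
    have "(U * W) $$ (i, j) = (R * E) $$ (f i, g j)"
      using ij f g E(3,5) unfolding U_def W_def by (simp add: scalar_prod_def)
    then show "Matrix.mat r r (\<lambda>(i, j). Q $$ (f i, g j)) $$ (i, j) = (U * W) $$ (i, j)"
      using ij unfolding E(2)[symmetric] by simp
  qed (auto simp: U_def W_def)
  with nz have "Determinant.det (U * W) \<noteq> 0" unfolding minor_def by simp
  then obtain h where h: "\<And>i. i < r \<Longrightarrow> h i < n"
    and dh: "Determinant.det (Matrix.mat r r (\<lambda>(i, j). W $$ (h i, j))) \<noteq> 0"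
    using det_rect_mult_nonzero[of U r n W] unfolding U_def W_def by auto
  let ?N = "Matrix.mat r r (\<lambda>(i, j). W $$ (h i, j))"
  have "inj_on h {0..<r}"
  proof (rule inj_onI, rule ccontr)
    fix i j assume ij: "i \<in> {0..<r}" "j \<in> {0..<r}" "h i = h j" "i \<noteq> j"
    have "Determinant.det ?N = 0"
    proof (rule det_identical_rows[of _ r i j])
      show "Matrix.row ?N i = Matrix.row ?N j" using ij by (intro eq_vecI) auto
    qed (use ij in auto)
    with dh show False by simp
  qed
  moreover have "h ` {0..<r} \<subseteq> S"
  proof
    fix l assume "l \<in> h ` {0..<r}"
    then obtain i where i: "i < r" "l = h i" by auto
    show "l \<in> S"
    proof (rule ccontr)
      assume "l \<notin> S"
      then have r0: "Matrix.row E l = 0\<^sub>v n" using h i unfolding S_def by auto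
      have E0: "E $$ (l, j) = 0" if "j < n" for j
      proof -
        have "E $$ (l, j) = vec_index (Matrix.row E l) j" using that E(3) h i by auto
        then show ?thesis using r0 that by simp
      qed
      have row0: "Matrix.row ?N i = 0\<^sub>v r"
        using E0 g h i by (intro eq_vecI) (auto simp: W_def)
      have "Determinant.det ?N = (\<Sum>p | p permutes {0..<r}. signof p * (\<Prod>i = 0..<r. ?N $$ (i, p i)))"
        by (rule det_def') auto
      also have "\<dots> = 0"
      proof (rule sum.neutral, intro ballI)
        fix q assume "q \<in> {p. p permutes {0..<r}}"
        then have q: "q i < r" using i permutes_in_image[of q "{0..<r}" i] by auto
        have "?N $$ (i, q i) = vec_index (Matrix.row ?N i) (q i)" using i q by simp
        then have "?N $$ (i, q i) = 0" unfolding row0 using q by simp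
        then have "(\<Prod>i = 0..<r. ?N $$ (i, q i)) = 0" using i by (intro prod_zero) auto
        then show "signof q * (\<Prod>i = 0..<r. ?N $$ (i, q i)) = 0" by simp
      qed
      finally show False using dh by simp
    qed
  qed
  ultimately have "r \<le> card S"
    using card_inj_on_le[of h "{0..<r}" S] finS by auto
  moreover have "S \<subseteq> {0..<n}" unfolding S_def by auto
  then have "card S \<le> n" using card_mono[of "{0..<n}" S] by auto
  ultimately show ?thesis using kd unfolding S_def by auto
qed

section \<open>Polynomials in a matrix\<close>

definition poly_mat :: "'a::comm_ring_1 poly \<Rightarrow> 'a mat \<Rightarrow> 'a mat" where
  "poly_mat q A = Matrix.mat (dim_row A) (dim_row A)
     (\<lambda>(u, v). \<Sum>j\<le>degree q. poly.coeff q j * (A ^\<^sub>m j) $$ (u, v))"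

lemma poly_mat_carrier [simp]: "A \<in> carrier_mat n n \<Longrightarrow> poly_mat q A \<in> carrier_mat n n"
  by (auto simp: poly_mat_def)

lemma poly_mat_dim [simp]: "dim_row (poly_mat q A) = dim_row A" "dim_col (poly_mat q A) = dim_row A"
  by (auto simp: poly_mat_def)

lemma poly_mat_index:
  assumes "A \<in> carrier_mat n n" "u < n" "v < n" "degree q \<le> N"
  shows "poly_mat q A $$ (u, v) = (\<Sum>j\<le>N. poly.coeff q j * (A ^\<^sub>m j) $$ (u, v))"
proof -
  have "poly_mat q A $$ (u, v) = (\<Sum>j\<le>degree q. poly.coeff q j * (A ^\<^sub>m j) $$ (u, v))"
    using assms by (simp add: poly_mat_def)
  also have "\<dots> = (\<Sum>j\<le>N. poly.coeff q j * (A ^\<^sub>m j) $$ (u, v))"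
    using assms(4) by (intro sum.mono_neutral_left) (auto simp: coeff_eq_0)
  finally show ?thesis .
qed

lemma poly_mat_0: "A \<in> carrier_mat n n \<Longrightarrow> poly_mat 0 A = 0\<^sub>m n n"
  by (intro eq_matI) (auto simp: poly_mat_def)

lemma poly_mat_add:
  assumes A: "A \<in> carrier_mat n n"
  shows "poly_mat (p + q) A = poly_mat p A + poly_mat q A"
proof (rule eq_matI)
  fix u v assume "u < dim_row (poly_mat p A + poly_mat q A)" "v < dim_col (poly_mat p A + poly_mat q A)"
  then have uv: "u < n" "v < n" using A by auto
  let ?N = "max (degree p) (degree q)"
  have *: "degree (p + q) \<le> ?N" "degree p \<le> ?N" "degree q \<le> ?N" by (auto simp: degree_add_le_max)
  show "poly_mat (p + q) A $$ (u, v) = (poly_mat p A + poly_mat q A) $$ (u, v)"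
    using uv A by (simp add: poly_mat_index[OF A uv *(1)] poly_mat_index[OF A uv *(2)]
      poly_mat_index[OF A uv *(3)] sum.distrib algebra_simps)
qed (use A in auto)

lemma poly_mat_smult:
  assumes A: "A \<in> carrier_mat n n"
  shows "poly_mat (Polynomial.smult c p) A = c \<cdot>\<^sub>m poly_mat p A"
proof (rule eq_matI)
  fix u v assume "u < dim_row (c \<cdot>\<^sub>m poly_mat p A)" "v < dim_col (c \<cdot>\<^sub>m poly_mat p A)"
  then have uv: "u < n" "v < n" using A by auto
  show "poly_mat (Polynomial.smult c p) A $$ (u, v) = (c \<cdot>\<^sub>m poly_mat p A) $$ (u, v)"
    using uv A poly_mat_index[OF A uv order.refl, of p]
    by (simp add: poly_mat_index[OF A uv degree_smult_le] sum_distrib_left mult.assoc)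
qed (use A in auto)

lemma poly_mat_pCons:
  assumes A: "A \<in> carrier_mat n n"
  shows "poly_mat (pCons a q) A = a \<cdot>\<^sub>m 1\<^sub>m n + poly_mat q A * A"
proof (rule eq_matI)
  fix u v assume "u < dim_row (a \<cdot>\<^sub>m 1\<^sub>m n + poly_mat q A * A)" "v < dim_col (a \<cdot>\<^sub>m 1\<^sub>m n + poly_mat q A * A)"
  then have uv: "u < n" "v < n" using A by auto
  have pw: "(A ^\<^sub>m Suc j) $$ (u, v) = (\<Sum>l = 0..<n. (A ^\<^sub>m j) $$ (u, l) * A $$ (l, v))" for j
    using uv A by (simp add: scalar_prod_def)
  have "poly_mat (pCons a q) A $$ (u, v)
      = (\<Sum>j\<le>Suc (degree q). poly.coeff (pCons a q) j * (A ^\<^sub>m j) $$ (u, v))"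
    by (rule poly_mat_index[OF A uv degree_pCons_le])
  also have "\<dots> = a * (1\<^sub>m n) $$ (u, v) + (\<Sum>j\<le>degree q. poly.coeff q j * (A ^\<^sub>m Suc j) $$ (u, v))"
    unfolding sum.atMost_Suc_shift using A by simp
  also have "(\<Sum>j\<le>degree q. poly.coeff q j * (A ^\<^sub>m Suc j) $$ (u, v))
      = (\<Sum>l = 0..<n. (\<Sum>j\<le>degree q. poly.coeff q j * (A ^\<^sub>m j) $$ (u, l)) * A $$ (l, v))"
    unfolding pw sum_distrib_left sum_distrib_right
    by (subst sum.swap) (simp add: mult.assoc)
  also have "\<dots> = (\<Sum>l = 0..<n. poly_mat q A $$ (u, l) * A $$ (l, v))"
    using uv by (intro sum.cong) (auto simp: poly_mat_index[OF A uv(1) _ order.refl])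
  also have "\<dots> = (poly_mat q A * A) $$ (u, v)"
    using uv A by (simp add: scalar_prod_def)
  finally show "poly_mat (pCons a q) A $$ (u, v) = (a \<cdot>\<^sub>m 1\<^sub>m n + poly_mat q A * A) $$ (u, v)"
    using uv A by simp
qed (use A in auto)

lemma poly_mat_mult:
  assumes A: "A \<in> carrier_mat n n"
  shows "poly_mat (p * q) A = poly_mat p A * poly_mat q A"
proof (induction q)
  case 0
  then show ?case using A by (simp add: poly_mat_0)
next
  case (pCons a q)
  note C = poly_mat_carrier[OF A]
  have "poly_mat (p * pCons a q) A = a \<cdot>\<^sub>m poly_mat p A + poly_mat (p * q) A * A"
    unfolding mult_pCons_right poly_mat_add[OF A] poly_mat_smult[OF A] poly_mat_pCons[OF A]
    by (rule arg_cong[where f = "\<lambda>X. a \<cdot>\<^sub>m poly_mat p A + X"], intro eq_matI) (use A in auto)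
  also have "poly_mat (p * q) A * A = poly_mat p A * (poly_mat q A * A)"
    unfolding pCons.IH by (rule assoc_mult_mat) (use A in auto)
  also have "a \<cdot>\<^sub>m poly_mat p A = poly_mat p A * (a \<cdot>\<^sub>m 1\<^sub>m n)"
    using A by (simp add: mult_smult_distrib[of _ n n _ n])
  also have "\<dots> + poly_mat p A * (poly_mat q A * A) = poly_mat p A * (a \<cdot>\<^sub>m 1\<^sub>m n + poly_mat q A * A)"
    by (rule mult_add_distrib_mat[symmetric]) (use A in auto)
  finally show ?case unfolding poly_mat_pCons[OF A] .
qed

lemma poly_mat_linear:
  assumes A: "A \<in> carrier_mat n n"
  shows "poly_mat [:- c, 1:] A = char_matrix A c"
  using A by (intro eq_matI) (auto simp: poly_mat_pCons poly_mat_0 char_matrix_def)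

lemma poly_mat_1: "A \<in> carrier_mat n n \<Longrightarrow> poly_mat 1 A = 1\<^sub>m n"
  by (intro eq_matI) (auto simp: poly_mat_def)

lemma poly_mat_power:
  assumes A: "A \<in> carrier_mat n n"
  shows "poly_mat (q ^ k) A = poly_mat q A ^\<^sub>m k"
proof (induction k)
  case 0
  then show ?case using A by (simp add: poly_mat_1)
next
  case (Suc k)
  then show ?case unfolding power_Suc2 poly_mat_mult[OF A] by simp
qed

lemma poly_mat_similar_wit:
  assumes wit: "similar_mat_wit A B P Q"
  shows "similar_mat_wit (poly_mat q A) (poly_mat q B) P Q"
proof -
  define n where "n = dim_row A"
  note w = similar_mat_witD[OF n_def wit]
  have A: "A \<in> carrier_mat n n" and B: "B \<in> carrier_mat n n" and P: "P \<in> carrier_mat n n"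
    and Q: "Q \<in> carrier_mat n n" and PQ: "P * Q = 1\<^sub>m n" and QP: "Q * P = 1\<^sub>m n"
    and AB: "A = P * B * Q" using w by auto
  have "poly_mat q A = P * poly_mat q B * Q"
  proof (induction q)
    case 0
    then show ?case using A B P Q by (simp add: poly_mat_0)
  next
    case (pCons a q)
    let ?X = "poly_mat q B"
    have X: "?X \<in> carrier_mat n n" using B by simp
    have "poly_mat q A * A = P * ?X * Q * (P * B * Q)"
      unfolding pCons.IH by (rule arg_cong[OF AB])
    also have "\<dots> = P * ?X * (Q * P) * B * Q"
      using P Q X B by (simp add: assoc_mult_mat[of _ n n _ n _ n] mult_carrier_mat[of _ n n _ n])
    also have "\<dots> = P * (?X * B) * Q"
      unfolding QP using P Q X B by (simp add: assoc_mult_mat[of _ n n _ n _ n] mult_carrier_mat[of _ n n _ n])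
    finally have 1: "poly_mat q A * A = P * (?X * B) * Q" .
    have 2: "a \<cdot>\<^sub>m 1\<^sub>m n = P * (a \<cdot>\<^sub>m 1\<^sub>m n) * Q"
      unfolding PQ[symmetric] using P Q PQ
      by (metis mult_smult_assoc_mat mult_smult_distrib one_carrier_mat right_mult_one_mat)
    have "a \<cdot>\<^sub>m 1\<^sub>m n + P * (?X * B) * Q = (P * (a \<cdot>\<^sub>m 1\<^sub>m n) + P * (?X * B)) * Q"
      by (subst 2, rule add_mult_distrib_mat[symmetric]) (use P Q X B in auto)
    also have "P * (a \<cdot>\<^sub>m 1\<^sub>m n) + P * (?X * B) = P * (a \<cdot>\<^sub>m 1\<^sub>m n + ?X * B)"
      by (rule mult_add_distrib_mat[symmetric]) (use P Q X B in auto)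
    finally show ?case unfolding poly_mat_pCons[OF A] poly_mat_pCons[OF B] 1 .
  qed
  then show ?thesis
    by (intro similar_mat_witI[OF PQ QP]) (use A B P Q in auto)
qed

lemma poly_mat_four_block:
  assumes B: "B \<in> carrier_mat n n" and D: "D \<in> carrier_mat m m"
  shows "poly_mat q (four_block_mat B (0\<^sub>m n m) (0\<^sub>m m n) D)
    = four_block_mat (poly_mat q B) (0\<^sub>m n m) (0\<^sub>m m n) (poly_mat q D)"
    (is "poly_mat q ?A = ?F")
proof (rule eq_matI)
  have A: "?A \<in> carrier_mat (n + m) (n + m)" using B D by simp
  have dB: "dim_row B = n" "dim_col B = n" "dim_row D = m" "dim_col D = m" using B D by auto
  fix u v assume "u < dim_row ?F" "v < dim_col ?F"
  then have uv: "u < n + m" "v < n + m" using B D by auto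
  have pw: "?A ^\<^sub>m j = four_block_mat (B ^\<^sub>m j) (0\<^sub>m n m) (0\<^sub>m m n) (D ^\<^sub>m j)" for j
    by (rule pow_four_block_mat[OF B D])
  have dBj: "dim_row (B ^\<^sub>m j) = n" "dim_col (B ^\<^sub>m j) = n" "dim_row (D ^\<^sub>m j) = m"
    "dim_col (D ^\<^sub>m j) = m" for j using B D by auto
  show "poly_mat q ?A $$ (u, v) = ?F $$ (u, v)"
    unfolding poly_mat_index[OF A uv order.refl] pw
    using uv by (cases "u < n"; cases "v < n")
      (auto simp: dB dBj poly_mat_index[OF B _ _ order.refl] poly_mat_index[OF D _ _ order.refl]
        intro!: sum.cong sum.neutral)
qed (use B D in auto)

lemma poly_mat_jordan_block_upper:
  fixes q :: "'a::field poly"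
  shows "upper_triangular (poly_mat q (jordan_block n c))"
    and "diag_mat (poly_mat q (jordan_block n c)) = replicate n (poly q c)"
proof -
  have J: "jordan_block n c \<in> carrier_mat n n" by simp
  show "upper_triangular (poly_mat q (jordan_block n c))"
  proof (rule upper_triangularI)
    fix i j assume ij: "j < i" "i < dim_row (poly_mat q (jordan_block n c))"
    then have ij': "i < n" "j < n" by auto
    show "poly_mat q (jordan_block n c) $$ (i, j) = 0"
      unfolding poly_mat_index[OF J ij' order.refl] jordan_block_pow using ij ij' by simp
  qed
  show "diag_mat (poly_mat q (jordan_block n c)) = replicate n (poly q c)"
  proof (rule nth_equalityI)
    fix i assume "i < length (diag_mat (poly_mat q (jordan_block n c)))"
    then have i: "i < n" by (simp add: diag_mat_def)
    then have "diag_mat (poly_mat q (jordan_block n c)) ! i = poly_mat q (jordan_block n c) $$ (i, i)"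
      by (simp add: diag_mat_def)
    also have "\<dots> = poly q c"
      unfolding poly_mat_index[OF J i i order.refl] jordan_block_pow poly_altdef using i by simp
    finally show "diag_mat (poly_mat q (jordan_block n c)) ! i = replicate n (poly q c) ! i"
      using i by simp
  qed (simp add: diag_mat_def)
qed

text \<open>On a Jordan block with eigenvalue $c$ the factor $q$ acts as an upper triangular matrix with
the nonzero entry $q(c)$ on the diagonal, hence invertibly; only the nilpotent part contributes to
the kernel.\<close>

lemma kernel_dim_poly_mat_jordan_block:
  fixes c :: "'a::field"
  assumes "poly q c \<noteq> 0"
  shows "kernel_dim (poly_mat ([:- c, 1:] ^ k * q) (jordan_block b c)) = min k b"
proof -
  let ?J = "jordan_block b c" and ?N = "jordan_block b (0::'a) ^\<^sub>m k"
  have J: "?J \<in> carrier_mat b b" by simp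
  have R: "poly_mat q ?J \<in> carrier_mat b b" by simp
  have "poly_mat [:- c, 1:] ?J = jordan_block b 0"
    unfolding poly_mat_linear[OF J] char_matrix_jordan_block by simp
  then have eq: "poly_mat ([:- c, 1:] ^ k * q) ?J = ?N * poly_mat q ?J"
    unfolding poly_mat_mult[OF J] poly_mat_power[OF J] by simp
  have "Determinant.det (poly_mat q ?J) = prod_list (replicate b (poly q c))"
    using det_upper_triangular[OF poly_mat_jordan_block_upper(1) R]
    unfolding poly_mat_jordan_block_upper(2) .
  then have "Determinant.det (poly_mat q ?J) \<noteq> 0" using assms by simp
  from det_non_zero_imp_unit[OF R this, of undefined]
  obtain C where C: "C \<in> carrier_mat b b" "poly_mat q ?J * C = 1\<^sub>m b"
    unfolding Units_def ring_mat_def by auto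
  have "kernel.dim b (?N * poly_mat q ?J) = kernel.dim b ?N"
    by (rule mat_kernel_dim_mult_eq_right[OF _ R C]) auto
  also have "\<dots> = min k b" by (rule dim_kernel_zero_jordan_block_pow)
  finally show ?thesis unfolding kernel_dim_def eq by simp
qed

lemma kernel_dim_poly_mat_jordan_matrix:
  fixes q :: "'a::field poly"
  assumes "\<And>b c. (b, c) \<in> set n_as \<Longrightarrow> \<exists>q'. q = [:- c, 1:] ^ k * q' \<and> poly q' c \<noteq> 0"
  shows "kernel_dim (poly_mat q (jordan_matrix n_as)) = (\<Sum>(b, c)\<leftarrow>n_as. min k b)"
  using assms
proof (induction n_as)
  case Nil
  have "jordan_matrix [] = (1\<^sub>m 0 :: 'a mat)"
    unfolding jordan_matrix_def by (intro eq_matI) auto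
  then have "poly_mat q (jordan_matrix []) = 1\<^sub>m 0" by (intro eq_matI) auto
  then show ?case using kernel_one_mat[of 0, where 'a='a] unfolding kernel_dim_def by simp
next
  case (Cons bc n_as)
  obtain b c where bc: "bc = (b, c)" by force
  let ?s = "sum_list (map fst n_as)"
  have J: "jordan_block b c \<in> carrier_mat b b" and M: "jordan_matrix n_as \<in> carrier_mat ?s ?s" by auto
  obtain q' where q': "q = [:- c, 1:] ^ k * q'" "poly q' c \<noteq> 0"
    using Cons.prems[of b c] bc by auto
  have "jordan_matrix (bc # n_as) = four_block_mat (jordan_block b c) (0\<^sub>m b ?s) (0\<^sub>m ?s b) (jordan_matrix n_as)"
    unfolding bc jordan_matrix_def using M unfolding jordan_matrix_def by (simp add: Let_def)
  then have "poly_mat q (jordan_matrix (bc # n_as))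
      = four_block_mat (poly_mat q (jordan_block b c)) (0\<^sub>m b ?s) (0\<^sub>m ?s b) (poly_mat q (jordan_matrix n_as))"
    using poly_mat_four_block[OF J M] by simp
  then have "kernel.dim (b + ?s) (poly_mat q (jordan_matrix (bc # n_as)))
      = kernel.dim b (poly_mat q (jordan_block b c)) + kernel.dim ?s (poly_mat q (jordan_matrix n_as))"
    by (rule kernel_four_block_0_mat) auto
  then have "kernel_dim (poly_mat q (jordan_matrix (bc # n_as)))
      = kernel_dim (poly_mat q (jordan_block b c)) + kernel_dim (poly_mat q (jordan_matrix n_as))"
    unfolding kernel_dim_def by (simp add: bc)
  also have "kernel_dim (poly_mat q (jordan_block b c)) = min k b"
    unfolding q'(1) by (rule kernel_dim_poly_mat_jordan_block[OF q'(2)])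
  also have "kernel_dim (poly_mat q (jordan_matrix n_as)) = (\<Sum>(b, c)\<leftarrow>n_as. min k b)"
    by (rule Cons.IH) (use Cons.prems in \<open>meson list.set_intros(2)\<close>)
  finally show ?case by (simp add: bc)
qed

section \<open>Power traces, Hankel determinants and Jordan blocks\<close>

definition mtrace :: "'a::comm_ring_1 mat \<Rightarrow> 'a" where
  "mtrace X = (\<Sum>i<dim_row X. X $$ (i, i))"

lemma mtrace_comm:
  assumes X: "X \<in> carrier_mat n n" and Y: "Y \<in> carrier_mat n n"
  shows "mtrace (X * Y) = mtrace (Y * X)"
proof -
  have "mtrace (X * Y) = (\<Sum>i<n. \<Sum>l<n. X $$ (i, l) * Y $$ (l, i))"
    using X Y by (auto simp: mtrace_def scalar_prod_def atLeast0LessThan intro!: sum.cong)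
  also have "\<dots> = (\<Sum>l<n. \<Sum>i<n. Y $$ (l, i) * X $$ (i, l))"
    by (subst sum.swap) (simp add: mult.commute)
  also have "\<dots> = mtrace (Y * X)"
    using X Y by (auto simp: mtrace_def scalar_prod_def atLeast0LessThan intro!: sum.cong)
  finally show ?thesis .
qed

lemma mtrace_four_block:
  assumes "B \<in> carrier_mat n n" "D \<in> carrier_mat m m"
  shows "mtrace (four_block_mat B (0\<^sub>m n m) (0\<^sub>m m n) D) = mtrace B + mtrace D"
proof -
  let ?F = "four_block_mat B (0\<^sub>m n m) (0\<^sub>m m n) D"
  have "mtrace ?F = (\<Sum>i<n + m. if i < n then B $$ (i, i) else D $$ (i - n, i - n))"
    using assms unfolding mtrace_def by (intro sum.cong) auto
  also have "\<dots> = (\<Sum>i<n. B $$ (i, i)) + (\<Sum>i<m. D $$ (i, i))"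
    unfolding lessThan_atLeast0 sum.atLeastLessThan_concat[symmetric, of 0 n "n + m", simplified]
    using sum.shift_bounds_nat_ivl[of "\<lambda>i. if i < n then B $$ (i, i) else D $$ (i - n, i - n)" 0 n m]
    by (simp add: add.commute)
  finally show ?thesis using assms unfolding mtrace_def by auto
qed

text \<open>Off-diagonal ones of the Jordan blocks do not reach the diagonal of a power, so power traces see
the eigenvalues with multiplicity and nothing else.\<close>

lemma mtrace_jordan_matrix_pow:
  fixes n_as :: "(nat \<times> 'a::comm_ring_1) list"
  shows "mtrace (jordan_matrix n_as ^\<^sub>m m) = (\<Sum>(b, c)\<leftarrow>n_as. of_nat b * c ^ m)"
proof (induction n_as)
  case Nil
  have "dim_row (jordan_matrix ([] :: (nat \<times> 'a) list) ^\<^sub>m m) = 0"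
    using pow_carrier_mat[OF jordan_matrix_carrier[of "[]"]] by simp
  then show ?case by (simp add: mtrace_def del: pow_mat_dim)
next
  case (Cons bc n_as)
  obtain b c where bc: "bc = (b, c)" by force
  let ?s = "sum_list (map fst n_as)"
  have M: "jordan_matrix n_as \<in> carrier_mat ?s ?s" by auto
  have "jordan_matrix (bc # n_as) ^\<^sub>m m
      = four_block_mat (jordan_block b c ^\<^sub>m m) (0\<^sub>m b ?s) (0\<^sub>m ?s b) (jordan_matrix n_as ^\<^sub>m m)"
    unfolding bc jordan_matrix_Cons by (rule pow_four_block_mat[OF _ M]) auto
  then have "mtrace (jordan_matrix (bc # n_as) ^\<^sub>m m)
      = mtrace (jordan_block b c ^\<^sub>m m) + mtrace (jordan_matrix n_as ^\<^sub>m m)"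
    using mtrace_four_block[of "jordan_block b c ^\<^sub>m m" b "jordan_matrix n_as ^\<^sub>m m" ?s] M by auto
  also have "mtrace (jordan_block b c ^\<^sub>m m) = of_nat b * c ^ m"
    unfolding jordan_block_pow mtrace_def by simp
  finally show ?case using Cons by (simp add: bc)
qed

lemma complex_jordan_nf_exists:
  fixes \<Phi> :: "complex mat"
  assumes "\<Phi> \<in> carrier_mat n n"
  obtains n_as where "jordan_nf \<Phi> n_as"
proof -
  from char_poly_factorized[OF assms] obtain as where "char_poly \<Phi> = (\<Prod>a\<leftarrow>as. [:- a, 1:])" by auto
  from jordan_nf_exists[OF assms this] show ?thesis using that by auto
qed

lemma jordan_nf_wit:
  assumes "\<Phi> \<in> carrier_mat n n" "jordan_nf \<Phi> n_as"
  obtains P Q where "similar_mat_wit \<Phi> (jordan_matrix n_as) P Q"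
  using assms(2) that unfolding jordan_nf_def similar_mat_def by blast

lemma jordan_nf_sum_sizes:
  assumes \<Phi>: "\<Phi> \<in> carrier_mat n n" and "jordan_nf \<Phi> n_as"
  shows "sum_list (map fst n_as) = n"
proof -
  from jordan_nf_wit[OF assms] obtain P Q where wit: "similar_mat_wit \<Phi> (jordan_matrix n_as) P Q" .
  show ?thesis
    using carrier_matD(1)[OF similar_mat_witD2(5)[OF \<Phi> wit]] unfolding jordan_matrix_dim .
qed

lemma power_trace_jordan_nf:
  assumes \<Phi>: "\<Phi> \<in> carrier_mat n n" and jnf: "jordan_nf \<Phi> n_as"
  shows "mtrace (\<Phi> ^\<^sub>m m) = (\<Sum>(b, c)\<leftarrow>n_as. of_nat b * c ^ m)"
proof -
  from jordan_nf_wit[OF assms] obtain P Q where wit: "similar_mat_wit \<Phi> (jordan_matrix n_as) P Q" .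
  let ?Y = "jordan_matrix n_as ^\<^sub>m m"
  note w = similar_mat_witD2[OF \<Phi> wit]
  have Y: "?Y \<in> carrier_mat n n" using w(5) by simp
  have "mtrace (\<Phi> ^\<^sub>m m) = mtrace (P * (?Y * Q))"
    unfolding similar_mat_wit_pow_id[OF wit] using assoc_mult_mat[OF w(6) Y w(7)] by simp
  also have "\<dots> = mtrace (?Y * Q * P)"
    by (rule mtrace_comm[OF w(6) mult_carrier_mat[OF Y w(7)]])
  also have "?Y * Q * P = ?Y"
    unfolding assoc_mult_mat[OF Y w(7,6)] w(2) by (rule right_mult_one_mat[OF Y])
  finally show ?thesis unfolding mtrace_jordan_matrix_pow .
qed

lemma jordan_nf_spectrum:
  fixes \<Phi> :: "complex mat"
  assumes \<Phi>: "\<Phi> \<in> carrier_mat n n" and jnf: "jordan_nf \<Phi> n_as"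
  shows "spectrum \<Phi> = snd ` set n_as"
proof -
  have 0: "0 \<notin> fst ` set n_as" using jnf unfolding jordan_nf_def by auto
  have "poly (\<Prod>(b, c)\<leftarrow>n_as. [:- c, 1:] ^ b) x = 0 \<longleftrightarrow> x \<in> snd ` set n_as" for x
    using 0 by (induction n_as) (auto simp: poly_mult)
  then show ?thesis
    unfolding spectrum_root_char_poly[OF \<Phi>] jordan_nf_char_poly[OF jnf] by auto
qed

text \<open>The polynomial $tr ((t - \<Phi>)^k \<Phi>^m)$ in the variable $t$, expanded by the binomial theorem.\<close>

definition shifted_trace_poly :: "nat \<Rightarrow> nat \<Rightarrow> complex mat \<Rightarrow> complex poly" where
  "shifted_trace_poly k m \<Phi> =
     (\<Sum>s\<le>k. monom (of_nat (k choose s) * (-1) ^ (k - s) * mtrace (\<Phi> ^\<^sub>m (k - s + m))) s)"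

lemma linear_poly_power:
  fixes c :: "'a::comm_ring_1"
  shows "[:- c, 1:] ^ k = (\<Sum>s\<le>k. monom (of_nat (k choose s) * (-1) ^ (k - s) * c ^ (k - s)) s)"
proof -
  have "[:- c, 1:] = monom 1 1 + [:- c:]" by (simp add: monom_altdef)
  then have "[:- c, 1:] ^ k = (\<Sum>s\<le>k. of_nat (k choose s) * monom 1 1 ^ s * [:- c:] ^ (k - s))"
    by (simp only: binomial_ring)
  also have "\<dots> = (\<Sum>s\<le>k. monom (of_nat (k choose s) * (-1) ^ (k - s) * c ^ (k - s)) s)"
  proof (intro sum.cong refl)
    fix s
    have "[:- c:] ^ j = [: (-1) ^ j * c ^ j :]" for j
      by (induction j) (auto simp: one_pCons)
    then show "of_nat (k choose s) * monom 1 1 ^ s * [:- c:] ^ (k - s)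
        = monom (of_nat (k choose s) * (-1) ^ (k - s) * c ^ (k - s)) s"
      by (simp add: monom_power smult_monom of_nat_poly mult_ac)
  qed
  finally show ?thesis .
qed

lemma shifted_trace_poly_jordan_nf:
  assumes \<Phi>: "\<Phi> \<in> carrier_mat n n" and jnf: "jordan_nf \<Phi> n_as"
  shows "shifted_trace_poly k m \<Phi>
    = (\<Sum>(b, c)\<leftarrow>n_as. Polynomial.smult (of_nat b * c ^ m) ([:- c, 1:] ^ k))"
proof -
  have "(\<Sum>s\<le>k. monom (of_nat (k choose s) * (-1) ^ (k - s)
        * (\<Sum>(b, c)\<leftarrow>xs. of_nat b * c ^ (k - s + m))) s)
      = (\<Sum>(b, c)\<leftarrow>xs. Polynomial.smult (of_nat b * c ^ m) ([:- c, 1:] ^ k))"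
    for xs :: "(nat \<times> complex) list"
  proof (induction xs)
    case (Cons bc xs)
    obtain b c where bc: "bc = (b, c)" by force
    have "Polynomial.smult (of_nat b * c ^ m) ([:- c, 1:] ^ k)
        = (\<Sum>s\<le>k. monom (of_nat (k choose s) * (-1) ^ (k - s) * (of_nat b * c ^ (k - s + m))) s)"
      unfolding linear_poly_power smult_sum2
      by (intro sum.cong refl) (simp only: smult_monom power_add mult_ac)
    then show ?case
      unfolding bc list.map sum_list.Cons split Cons.IH[symmetric] distrib_left add_monom[symmetric]
        sum.distrib by simp
  qed auto
  then show ?thesis
    unfolding shifted_trace_poly_def power_trace_jordan_nf[OF assms] .
qed

text \<open>For the measure on the spectrum that gives each eigenvalue its multiplicity, these are the Hankel
determinants of the moments, with the weight $(t - x)^k$ inserted in the first one.\<close>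

definition hankel_poly :: "nat \<Rightarrow> nat \<Rightarrow> complex mat \<Rightarrow> complex poly" where
  "hankel_poly M k \<Phi> = Determinant.det (Matrix.mat M M (\<lambda>(i, j). shifted_trace_poly k (i + j) \<Phi>))"

definition hankel_disc :: "nat \<Rightarrow> complex mat \<Rightarrow> complex" where
  "hankel_disc M \<Phi> = Determinant.det (Matrix.mat M M (\<lambda>(i, j). mtrace (\<Phi> ^\<^sub>m (i + j))))"

definition vandermonde :: "nat \<Rightarrow> (nat \<Rightarrow> complex) \<Rightarrow> complex mat" where
  "vandermonde M lam = Matrix.mat M M (\<lambda>(l, j). lam l ^ j)"

text \<open>A vector in the kernel is the coefficient vector of a polynomial of degree less than $M$ with
the $M$ roots $lam(0), ..., lam(M-1)$.\<close>

lemma vandermonde_det_nonzero: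
  assumes inj: "inj_on lam {0..<M}"
  shows "Determinant.det (vandermonde M lam) \<noteq> 0"
proof
  assume "Determinant.det (vandermonde M lam) = 0"
  moreover have V: "vandermonde M lam \<in> carrier_mat M M" by (simp add: vandermonde_def)
  ultimately obtain v where v: "v \<in> carrier_vec M" "v \<noteq> 0\<^sub>v M" "vandermonde M lam *\<^sub>v v = 0\<^sub>v M"
    using det_0_iff_vec_prod_zero_field[OF V] by auto
  define q where "q = (\<Sum>j<M. monom (vec_index v j) j)"
  have coeff_q: "poly.coeff q j = (if j < M then vec_index v j else 0)" for j
    unfolding q_def coeff_sum by (simp add: sum.delta)
  have root: "poly q (lam l) = 0" if "l < M" for l
  proof -
    have "poly q (lam l) = (\<Sum>j<M. vec_index v j * lam l ^ j)"
      unfolding q_def poly_sum by (simp add: poly_monom)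
    also have "\<dots> = vec_index (vandermonde M lam *\<^sub>v v) l"
      using that v(1) by (simp add: vandermonde_def scalar_prod_def mult.commute atLeast0LessThan)
    finally show ?thesis using v(3) that by simp
  qed
  have "q \<noteq> 0"
  proof
    assume "q = 0"
    then have "vec_index v j = 0" if "j < M" for j using coeff_q[of j] that by simp
    then have "v = 0\<^sub>v M" using v(1) by (intro eq_vecI) auto
    with v(2) show False ..
  qed
  moreover have "degree q < M"
  proof (rule ccontr)
    assume "\<not> degree q < M"
    then have "poly.coeff q (degree q) = 0" by (simp add: coeff_q)
    with \<open>q \<noteq> 0\<close> show False by simp
  qed
  moreover have "card (lam ` {0..<M}) \<le> card {x. poly q x = 0}"
    using root poly_roots_finite[OF \<open>q \<noteq> 0\<close>] by (intro card_mono) auto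
  then have "M \<le> card {x. poly q x = 0}" using card_image[OF inj] by simp
  ultimately show False using card_poly_roots_bound[of q] by linarith
qed

definition eigenvalue_weight :: "(nat \<times> complex) list \<Rightarrow> complex \<Rightarrow> nat" where
  "eigenvalue_weight n_as x = (\<Sum>(b, c)\<leftarrow>n_as. if c = x then b else 0)"

text \<open>The list $lam$ may contain numbers that are not eigenvalues; they enter with weight zero. This is what
makes the factorization below uniform in the number of eigenvalues, as long as there are at most $M$.\<close>

lemma sum_list_by_eigenvalue:
  fixes g :: "complex \<Rightarrow> 'b::comm_ring_1" and lam :: "nat \<Rightarrow> complex"
  assumes inj: "inj_on lam {0..<M}" and sub: "snd ` set n_as \<subseteq> lam ` {0..<M}"
  shows "(\<Sum>(b, c)\<leftarrow>n_as. of_nat b * g c)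
    = (\<Sum>l = 0..<M. of_nat (eigenvalue_weight n_as (lam l)) * g (lam l))"
  using sub
proof (induction n_as)
  case Nil
  then show ?case by (simp add: eigenvalue_weight_def)
next
  case (Cons bc n_as)
  obtain b c where bc: "bc = (b, c)" by force
  from Cons.prems obtain l0 where l0: "l0 < M" "c = lam l0" by (auto simp: bc)
  have "(\<Sum>l = 0..<M. of_nat (if c = lam l then b else 0) * g (lam l))
      = (\<Sum>l = 0..<M. if l = l0 then of_nat b * g (lam l) else 0)"
  proof (intro sum.cong refl)
    fix l assume "l \<in> {0..<M}"
    then have "lam l = lam l0 \<longleftrightarrow> l = l0"
      by (intro inj_on_eq_iff[OF inj]) (use l0 in auto)
    then have "c = lam l \<longleftrightarrow> l = l0" using l0 by auto
    then show "of_nat (if c = lam l then b else 0) * g (lam l) = (if l = l0 then of_nat b * g (lam l) else 0)"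
      by simp
  qed
  also have "\<dots> = of_nat b * g c" using l0 by (simp add: sum.delta)
  finally have *: "(\<Sum>l = 0..<M. of_nat (if c = lam l then b else 0) * g (lam l)) = of_nat b * g c" .
  have "(\<Sum>l = 0..<M. of_nat (eigenvalue_weight (bc # n_as) (lam l)) * g (lam l))
    = (\<Sum>l = 0..<M. of_nat (if c = lam l then b else 0) * g (lam l))
     + (\<Sum>l = 0..<M. of_nat (eigenvalue_weight n_as (lam l)) * g (lam l))"
    unfolding sum.distrib[symmetric] by (intro sum.cong) (auto simp: eigenvalue_weight_def bc distrib_right)
  then show ?case using Cons unfolding * by (simp add: bc)
qed

lemma det_diag_congruence:
  fixes V :: "'a::comm_ring_1 mat"
  assumes V: "V \<in> carrier_mat M M"
  shows "Determinant.det (transpose_mat V * (mat_diag M d * V))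
    = Determinant.det V * ((\<Prod>l = 0..<M. d l) * Determinant.det V)"
proof -
  have D: "Determinant.det (mat_diag M d) = (\<Prod>l = 0..<M. d l)"
    by (subst det_upper_triangular[of _ M]) (auto simp: mat_diag_def prod_list_diag_prod)
  have "Determinant.det (transpose_mat V * (mat_diag M d * V))
      = Determinant.det (transpose_mat V) * Determinant.det (mat_diag M d * V)"
    by (rule det_mult[of _ M]) (use V mult_carrier_mat[OF mat_diag_dim V] in auto)
  also have "Determinant.det (mat_diag M d * V) = (\<Prod>l = 0..<M. d l) * Determinant.det V"
    unfolding D[symmetric] by (rule det_mult[OF mat_diag_dim V])
  finally show ?thesis unfolding det_transpose[OF V] .
qed

text \<open>A moment matrix is $V^T diag(w) V$ with the Vandermonde matrix $V$ of the nodes, here with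
weights $w_l (t - lam(l))^k$. All three factors are square, because $M$ nodes are enough, so the
determinant is the product of the determinants.\<close>

lemma hankel_factorization:
  assumes \<Phi>: "\<Phi> \<in> carrier_mat n n" and jnf: "jordan_nf \<Phi> n_as"
    and inj: "inj_on lam {0..<M}" and sub: "spectrum \<Phi> \<subseteq> lam ` {0..<M}"
  defines "\<delta> \<equiv> Determinant.det (vandermonde M lam) ^ 2 * (\<Prod>l = 0..<M. of_nat (eigenvalue_weight n_as (lam l)))"
  shows "hankel_poly M k \<Phi> = Polynomial.smult \<delta> (\<Prod>l = 0..<M. [:- lam l, 1:] ^ k)"
    and "hankel_disc M \<Phi> = \<delta>"
proof -
  let ?w = "\<lambda>l. eigenvalue_weight n_as (lam l)"
  have sub': "snd ` set n_as \<subseteq> lam ` {0..<M}"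
    using sub jordan_nf_spectrum[OF \<Phi> jnf] by simp
  let ?V = "vandermonde M lam"
  have V: "?V \<in> carrier_mat M M" by (simp add: vandermonde_def)
  interpret C: comm_ring_hom "\<lambda>x::complex. [:x:]"
    by unfold_locales (auto simp: one_pCons)
  let ?V' = "map_mat (\<lambda>x. [:x:]) ?V"
  have V': "?V' \<in> carrier_mat M M" using V by simp
  let ?d = "\<lambda>l. of_nat (?w l) * [:- lam l, 1:] ^ k :: complex poly"
  have eq: "Matrix.mat M M (\<lambda>(i, j). shifted_trace_poly k (i + j) \<Phi>)
      = transpose_mat ?V' * (mat_diag M ?d * ?V')"
  proof (rule eq_matI)
    fix i j assume "i < dim_row (transpose_mat ?V' * (mat_diag M ?d * ?V'))"
      "j < dim_col (transpose_mat ?V' * (mat_diag M ?d * ?V'))"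
    then have ij: "i < M" "j < M" using V by auto
    have "(transpose_mat ?V' * (mat_diag M ?d * ?V')) $$ (i, j)
        = (\<Sum>l = 0..<M. [:lam l ^ i:] * (?d l * [:lam l ^ j:]))"
      unfolding mat_diag_mult_left[OF V'] using ij V
      by (auto simp: scalar_prod_def vandermonde_def intro!: sum.cong)
    also have "\<dots> = (\<Sum>l = 0..<M. of_nat (?w l) * (\<lambda>c. Polynomial.smult (c ^ (i + j)) ([:- c, 1:] ^ k)) (lam l))"
      by (intro sum.cong) (auto simp: power_add mult_ac)
    also have "\<dots> = (\<Sum>(b, c)\<leftarrow>n_as. of_nat b * Polynomial.smult (c ^ (i + j)) ([:- c, 1:] ^ k))"
      by (rule sum_list_by_eigenvalue[OF inj sub', symmetric])
    also have "\<dots> = shifted_trace_poly k (i + j) \<Phi>"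
      unfolding shifted_trace_poly_jordan_nf[OF \<Phi> jnf]
      by (intro arg_cong[where f = sum_list] map_cong) (auto simp: of_nat_poly)
    finally show "Matrix.mat M M (\<lambda>(i, j). shifted_trace_poly k (i + j) \<Phi>) $$ (i, j)
      = (transpose_mat ?V' * (mat_diag M ?d * ?V')) $$ (i, j)" using ij by simp
  qed (use V in auto)
  have "hankel_poly M k \<Phi> = Determinant.det ?V' * ((\<Prod>l = 0..<M. ?d l) * Determinant.det ?V')"
    unfolding hankel_poly_def eq
    by (rule det_diag_congruence[OF V'])
  also have "Determinant.det ?V' = [:Determinant.det ?V:]" by simp
  also have "(\<Prod>l = 0..<M. ?d l) = [:\<Prod>l = 0..<M. of_nat (?w l):] * (\<Prod>l = 0..<M. [:- lam l, 1:] ^ k)"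
    unfolding prod.distrib C.hom_prod by (simp add: of_nat_poly)
  finally show "hankel_poly M k \<Phi> = Polynomial.smult \<delta> (\<Prod>l = 0..<M. [:- lam l, 1:] ^ k)"
    unfolding \<delta>_def by (simp add: power2_eq_square mult_ac)
  have "Matrix.mat M M (\<lambda>(i, j). mtrace (\<Phi> ^\<^sub>m (i + j)))
      = transpose_mat ?V * (mat_diag M (\<lambda>l. of_nat (?w l)) * ?V)"
  proof (rule eq_matI)
    fix i j assume "i < dim_row (transpose_mat ?V * (mat_diag M (\<lambda>l. of_nat (?w l)) * ?V))"
      "j < dim_col (transpose_mat ?V * (mat_diag M (\<lambda>l. of_nat (?w l)) * ?V))"
    then have ij: "i < M" "j < M" using V by auto
    have "(transpose_mat ?V * (mat_diag M (\<lambda>l. of_nat (?w l)) * ?V)) $$ (i, j)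
        = (\<Sum>l = 0..<M. of_nat (?w l) * (\<lambda>c. c ^ (i + j)) (lam l))"
      unfolding mat_diag_mult_left[OF V] using ij V
      by (auto simp: scalar_prod_def vandermonde_def power_add mult_ac intro!: sum.cong)
    also have "\<dots> = (\<Sum>(b, c)\<leftarrow>n_as. of_nat b * c ^ (i + j))"
      by (rule sum_list_by_eigenvalue[OF inj sub', symmetric])
    finally show "Matrix.mat M M (\<lambda>(i, j). mtrace (\<Phi> ^\<^sub>m (i + j))) $$ (i, j)
      = (transpose_mat ?V * (mat_diag M (\<lambda>l. of_nat (?w l)) * ?V)) $$ (i, j)"
      using ij by (simp add: power_trace_jordan_nf[OF \<Phi> jnf])
  qed (use V in auto)
  then have "hankel_disc M \<Phi> = Determinant.det ?V * ((\<Prod>l = 0..<M. of_nat (?w l)) * Determinant.det ?V)"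
    unfolding hankel_disc_def
    by (simp only: det_diag_congruence[OF V])
  then show "hankel_disc M \<Phi> = \<delta>"
    unfolding \<delta>_def by (simp add: power2_eq_square mult_ac)
qed

text \<open>If there are fewer than $M$ eigenvalues, arbitrary other numbers are added to get $M$ distinct
nodes.\<close>

lemma eigenvalue_enumeration:
  fixes S :: "complex set"
  assumes "finite S" "card S \<le> M"
  obtains lam where "inj_on lam {0..<M}" "S \<subseteq> lam ` {0..<M}"
    "card S = M \<longrightarrow> lam ` {0..<M} = S"
proof -
  have "infinite (UNIV - S :: complex set)" using assms infinite_UNIV_char_0 by simp
  then obtain T where T: "finite T" "card T = M - card S" "T \<subseteq> UNIV - S"
    using infinite_arbitrarily_large by blast
  then have "S \<inter> T = {}" by auto
  then have c: "finite (S \<union> T)" "card (S \<union> T) = M"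
    using assms T card_Un_disjoint[of S T] by auto
  from ex_bij_betw_nat_finite[OF c(1)] obtain lam where lam: "bij_betw lam {0..<M} (S \<union> T)"
    unfolding c(2) by auto
  show ?thesis
  proof (rule that[of lam])
    show "card S = M \<longrightarrow> lam ` {0..<M} = S"
      using T lam by (auto simp: bij_betw_def)
  qed (use lam in \<open>auto simp: bij_betw_def\<close>)
qed

lemma hankel_disc_nonzero_iff:
  assumes \<Phi>: "\<Phi> \<in> carrier_mat n n" and le: "card (spectrum \<Phi>) \<le> M"
  shows "hankel_disc M \<Phi> \<noteq> 0 \<longleftrightarrow> card (spectrum \<Phi>) = M"
proof -
  have fin: "finite (spectrum \<Phi>)" by (rule card_finite_spectrum[OF \<Phi>])
  obtain n_as where jnf: "jordan_nf \<Phi> n_as"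
    using complex_jordan_nf_exists[OF \<Phi>] .
  from eigenvalue_enumeration[OF fin le] obtain lam where lam: "inj_on lam {0..<M}"
    "spectrum \<Phi> \<subseteq> lam ` {0..<M}" "card (spectrum \<Phi>) = M \<longrightarrow> lam ` {0..<M} = spectrum \<Phi>" .
  have pos: "eigenvalue_weight n_as x \<noteq> 0 \<longleftrightarrow> x \<in> spectrum \<Phi>" for x
  proof -
    have "0 \<notin> fst ` set n_as" using jnf unfolding jordan_nf_def by auto
    then have "eigenvalue_weight n_as x \<noteq> 0 \<longleftrightarrow> x \<in> snd ` set n_as"
      unfolding eigenvalue_weight_def by (induction n_as) auto
    then show ?thesis using jordan_nf_spectrum[OF \<Phi> jnf] by simp
  qed
  have "hankel_disc M \<Phi> \<noteq> 0 \<longleftrightarrow> (\<forall>l\<in>{0..<M}. lam l \<in> spectrum \<Phi>)"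
    unfolding hankel_factorization(2)[OF \<Phi> jnf lam(1,2)]
    using vandermonde_det_nonzero[OF lam(1)] pos by simp
  also have "\<dots> \<longleftrightarrow> lam ` {0..<M} = spectrum \<Phi>" using lam(2) by auto
  also have "\<dots> \<longleftrightarrow> card (spectrum \<Phi>) = M"
    using lam(3) card_image[OF lam(1)] by auto
  finally show ?thesis .
qed

definition hankel_mat :: "nat \<Rightarrow> nat \<Rightarrow> complex mat \<Rightarrow> complex mat" where
  "hankel_mat M k \<Phi> = poly_mat (hankel_poly M k \<Phi>) \<Phi>"

definition hankel_rank :: "nat \<Rightarrow> nat \<Rightarrow> complex mat \<Rightarrow> nat" where
  "hankel_rank M k \<Phi> = dim_row \<Phi> - kernel_dim (hankel_mat M k \<Phi>)"

text \<open>Up to the nonzero factor $D$ the matrix is $p(\<Phi>)^k$, and for each Jordan block $p$ has its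
eigenvalue as a simple root. So the block of size $b$ contributes $min(k, b)$ to the kernel and $b - k$
(truncated at zero) to the rank.\<close>

lemma hankel_rank_jordan_nf:
  assumes \<Phi>: "\<Phi> \<in> carrier_mat n n" and jnf: "jordan_nf \<Phi> n_as"
    and card: "card (spectrum \<Phi>) = M"
  shows "hankel_rank M k \<Phi> = (\<Sum>(b, c)\<leftarrow>n_as. b - k)"
proof -
  have fin: "finite (spectrum \<Phi>)" by (rule card_finite_spectrum[OF \<Phi>])
  from eigenvalue_enumeration[OF fin eq_refl[OF card]] obtain lam where lam0: "inj_on lam {0..<M}"
    "card (spectrum \<Phi>) = M \<longrightarrow> lam ` {0..<M} = spectrum \<Phi>" .
  have lam: "inj_on lam {0..<M}" "spectrum \<Phi> = lam ` {0..<M}"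
    using lam0 card by auto
  have nz: "hankel_disc M \<Phi> \<noteq> 0" using hankel_disc_nonzero_iff[OF \<Phi>] card by simp
  let ?q = "Polynomial.smult (hankel_disc M \<Phi>) (\<Prod>l = 0..<M. [:- lam l, 1:] ^ k)"
  have q: "hankel_poly M k \<Phi> = ?q"
    using hankel_factorization[OF \<Phi> jnf lam(1)] lam(2) by simp
  have "kernel_dim (poly_mat ?q (jordan_matrix n_as)) = (\<Sum>(b, c)\<leftarrow>n_as. min k b)"
  proof (rule kernel_dim_poly_mat_jordan_matrix)
    fix b c assume "(b, c) \<in> set n_as"
    then have "c \<in> snd ` set n_as" by force
    then obtain l0 where l0: "l0 \<in> {0..<M}" "c = lam l0"
      using lam(2) jordan_nf_spectrum[OF \<Phi> jnf] by auto
    let ?q' = "Polynomial.smult (hankel_disc M \<Phi>) (\<Prod>l\<in>{0..<M} - {l0}. [:- lam l, 1:] ^ k)"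
    have "?q = [:- c, 1:] ^ k * ?q'"
      unfolding l0(2) prod.remove[OF finite_atLeastLessThan l0(1)] by simp
    moreover have "poly ?q' c \<noteq> 0"
      using nz lam(1) l0 by (auto simp: poly_prod inj_on_def)
    ultimately show "\<exists>q'. ?q = [:- c, 1:] ^ k * q' \<and> poly q' c \<noteq> 0" by blast
  qed
  moreover have "kernel_dim (poly_mat ?q \<Phi>) = kernel_dim (poly_mat ?q (jordan_matrix n_as))"
  proof -
    from jordan_nf_wit[OF \<Phi> jnf] obtain P Q where wit: "similar_mat_wit \<Phi> (jordan_matrix n_as) P Q" .
    show ?thesis
      using similar_mat_wit_kernel_dim[OF poly_mat_carrier[OF \<Phi>] poly_mat_similar_wit[OF wit]]
        similar_mat_witD2(5)[OF \<Phi> wit] \<Phi> unfolding kernel_dim_def by auto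
  qed
  moreover have "(\<Sum>(b, c)\<leftarrow>xs. b - k) = sum_list (map fst xs) - (\<Sum>(b, c)\<leftarrow>xs. min k b)
      \<and> (\<Sum>(b, c)\<leftarrow>xs. min k b) \<le> sum_list (map fst xs)" for xs :: "(nat \<times> complex) list"
    by (induction xs) auto
  ultimately show ?thesis
    using jordan_nf_sum_sizes[OF \<Phi> jnf] \<Phi> unfolding hankel_rank_def hankel_mat_def q by auto
qed

section \<open>Norm estimates\<close>

lemma eucl_norm_nonneg [simp]: "eucl_norm v \<ge> 0"
  by (simp add: eucl_norm_def)

lemma vec_index_le_eucl_norm:
  assumes "v \<in> carrier_vec n" "i < n"
  shows "cmod (vec_index v i) \<le> eucl_norm v"
  unfolding eucl_norm_def using assms by (intro member_le_L2_set) auto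

lemma eucl_norm_smult: "eucl_norm (c \<cdot>\<^sub>v v) = cmod c * eucl_norm v"
proof -
  have "eucl_norm (c \<cdot>\<^sub>v v) = L2_set (\<lambda>i. cmod c * cmod (vec_index v i)) {..<dim_vec v}"
    unfolding eucl_norm_def by (intro L2_set_cong) (auto simp: norm_mult)
  then show ?thesis by (simp add: eucl_norm_def L2_set_right_distrib)
qed

text \<open>The supremum in the definition of the operator norm is over a bounded set, so it is an upper
bound; a bound is the sum of the moduli of the entries.\<close>

lemma mat_op_norm_upper:
  assumes \<Phi>: "\<Phi> \<in> carrier_mat n n" and v: "v \<in> carrier_vec n" "eucl_norm v \<le> 1"
  shows "eucl_norm (\<Phi> *\<^sub>v v) \<le> mat_op_norm \<Phi>"
proof -
  let ?S = "{v \<in> carrier_vec (dim_col \<Phi>). eucl_norm v \<le> 1}"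
  have "bdd_above ((\<lambda>v. eucl_norm (\<Phi> *\<^sub>v v)) ` ?S)"
  proof (rule bdd_aboveI2)
    fix w assume "w \<in> ?S"
    then have w: "w \<in> carrier_vec n" "eucl_norm w \<le> 1" using \<Phi> by auto
    have le: "cmod (vec_index (\<Phi> *\<^sub>v w) i) \<le> (\<Sum>j<n. cmod (\<Phi> $$ (i, j)))" if "i < n" for i
    proof -
      have "vec_index (\<Phi> *\<^sub>v w) i = (\<Sum>j<n. \<Phi> $$ (i, j) * vec_index w j)"
        using \<Phi> w that by (simp add: scalar_prod_def atLeast0LessThan)
      also have "cmod \<dots> \<le> (\<Sum>j<n. cmod (\<Phi> $$ (i, j)) * cmod (vec_index w j))"
        by (rule order.trans[OF norm_sum]) (simp add: norm_mult)
      also have "\<dots> \<le> (\<Sum>j<n. cmod (\<Phi> $$ (i, j)) * 1)"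
      proof (intro sum_mono mult_left_mono)
        fix j assume "j \<in> {..<n}"
        then show "cmod (vec_index w j) \<le> 1" using vec_index_le_eucl_norm[OF w(1), of j] w(2) by auto
      qed auto
      finally show ?thesis by simp
    qed
    have "eucl_norm (\<Phi> *\<^sub>v w) \<le> (\<Sum>i<n. cmod (vec_index (\<Phi> *\<^sub>v w) i))"
      unfolding eucl_norm_def using \<Phi> by (auto simp del: index_mult_mat_vec intro!: L2_set_le_sum)
    also have "\<dots> \<le> (\<Sum>i<n. \<Sum>j<n. cmod (\<Phi> $$ (i, j)))"
      using le by (intro sum_mono) auto
    finally show "eucl_norm (\<Phi> *\<^sub>v w) \<le> (\<Sum>i<n. \<Sum>j<n. cmod (\<Phi> $$ (i, j)))" .
  qed
  then show ?thesis
    unfolding mat_op_norm_def by (rule cSUP_upper[rotated]) (use v \<Phi> in auto)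
qed

lemma mat_op_norm_nonneg:
  assumes \<Phi>: "\<Phi> \<in> carrier_mat n n"
  shows "mat_op_norm \<Phi> \<ge> 0"
proof -
  have "eucl_norm (0\<^sub>v n) = 0" by (simp add: eucl_norm_def L2_set_def)
  then have "eucl_norm (\<Phi> *\<^sub>v 0\<^sub>v n) \<le> mat_op_norm \<Phi>"
    by (intro mat_op_norm_upper[OF \<Phi>]) auto
  then show ?thesis using eucl_norm_nonneg order.trans by blast
qed

lemma eucl_norm_mult_le:
  assumes \<Phi>: "\<Phi> \<in> carrier_mat n n" and v: "v \<in> carrier_vec n"
  shows "eucl_norm (\<Phi> *\<^sub>v v) \<le> mat_op_norm \<Phi> * eucl_norm v"
proof (cases "eucl_norm v = 0")
  case True
  then have "vec_index v i = 0" if "i < n" for i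
    using vec_index_le_eucl_norm[OF v that] by simp
  then have "v = 0\<^sub>v n" using v by (intro eq_vecI) auto
  then have "\<Phi> *\<^sub>v v = 0\<^sub>v n" using \<Phi> by (intro eq_vecI) auto
  then show ?thesis using True by (simp add: eucl_norm_def L2_set_def)
next
  case False
  define c where "c = eucl_norm v"
  have c: "c > 0" using False eucl_norm_nonneg[of v] unfolding c_def by linarith
  \<comment> \<open>The supremum controls only vectors of norm at most 1.\<close>
  define w where "w = complex_of_real (inverse c) \<cdot>\<^sub>v v"
  have w: "w \<in> carrier_vec n" unfolding w_def using v by simp
  have "eucl_norm w = cmod (complex_of_real (inverse c)) * eucl_norm v"
    unfolding w_def eucl_norm_smult ..
  then have wn: "eucl_norm w = 1" using c unfolding c_def[symmetric] by (simp add: norm_inverse)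
  have "v = complex_of_real c \<cdot>\<^sub>v w" unfolding w_def using c by (simp add: smult_smult_assoc)
  then have "\<Phi> *\<^sub>v v = complex_of_real c \<cdot>\<^sub>v (\<Phi> *\<^sub>v w)"
    using \<Phi> w by (simp add: mult_mat_vec[OF \<Phi> w])
  then have "eucl_norm (\<Phi> *\<^sub>v v) = c * eucl_norm (\<Phi> *\<^sub>v w)" using c by (simp add: eucl_norm_smult)
  also have "\<dots> \<le> c * mat_op_norm \<Phi>"
    using mat_op_norm_upper[OF \<Phi> w] wn c by (intro mult_left_mono) auto
  finally show ?thesis unfolding c_def by (simp add: mult.commute)
qed

lemma pow_mat_entry_le:
  assumes \<Phi>: "\<Phi> \<in> carrier_mat n n" and uv: "u < n" "v < n"
  shows "cmod ((\<Phi> ^\<^sub>m j) $$ (u, v)) \<le> mat_op_norm \<Phi> ^ j"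
proof -
  have *: "eucl_norm (\<Phi> ^\<^sub>m j *\<^sub>v w) \<le> mat_op_norm \<Phi> ^ j * eucl_norm w" if "w \<in> carrier_vec n" for w
    using that
  proof (induction j arbitrary: w)
    case 0
    then show ?case using \<Phi> by simp
  next
    case (Suc j)
    have "\<Phi> ^\<^sub>m Suc j *\<^sub>v w = \<Phi> ^\<^sub>m j *\<^sub>v (\<Phi> *\<^sub>v w)"
      using assoc_mult_mat_vec[OF pow_carrier_mat[OF \<Phi>] \<Phi> Suc.prems] by simp
    also have "eucl_norm \<dots> \<le> mat_op_norm \<Phi> ^ j * eucl_norm (\<Phi> *\<^sub>v w)"
      using \<Phi> Suc.prems by (intro Suc.IH) auto
    also have "\<dots> \<le> mat_op_norm \<Phi> ^ j * (mat_op_norm \<Phi> * eucl_norm w)"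
      using eucl_norm_mult_le[OF \<Phi> Suc.prems] mat_op_norm_nonneg[OF \<Phi>]
      by (intro mult_left_mono) auto
    finally show ?case by (simp add: mult_ac)
  qed
  have dim: "dim_row (\<Phi> ^\<^sub>m j) = n" "dim_col (\<Phi> ^\<^sub>m j) = n"
    using pow_carrier_mat[OF \<Phi>, of j] by (auto simp: carrier_matD)
  have "(\<Phi> ^\<^sub>m j) $$ (u, v) = vec_index (\<Phi> ^\<^sub>m j *\<^sub>v unit_vec n v) u"
    using uv dim by (simp add: scalar_prod_right_unit[of v n])
  also have "cmod \<dots> \<le> eucl_norm (\<Phi> ^\<^sub>m j *\<^sub>v unit_vec n v)"
    by (rule vec_index_le_eucl_norm[OF mult_mat_vec_carrier[OF pow_carrier_mat[OF \<Phi>] unit_vec_carrier] uv(1)])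
  also have "\<dots> \<le> mat_op_norm \<Phi> ^ j * eucl_norm (unit_vec n v)"
    by (rule *) simp
  also have "eucl_norm (unit_vec n v :: complex Matrix.vec) = 1"
  proof -
    have "(\<Sum>i<n. (cmod (if i = v then 1 else 0))\<^sup>2) = (\<Sum>i<n. if i = v then 1 else 0)"
      by (intro sum.cong) auto
    also have "\<dots> = 1" using uv by (simp add: sum.delta)
    finally show ?thesis
      unfolding eucl_norm_def L2_set_def using uv by (simp add: unit_vec_def)
  qed
  finally show ?thesis by simp
qed

lemma mat_entry_le:
  assumes \<Phi>: "\<Phi> \<in> carrier_mat n n" and uv: "u < n" "v < n"
  shows "cmod (\<Phi> $$ (u, v)) \<le> mat_op_norm \<Phi>"
  using pow_mat_entry_le[OF assms, of 1] \<Phi> by simp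

lemma mtrace_pow_le:
  assumes \<Phi>: "\<Phi> \<in> carrier_mat n n"
  shows "cmod (mtrace (\<Phi> ^\<^sub>m j)) \<le> real n * mat_op_norm \<Phi> ^ j"
proof -
  have dim: "dim_row (\<Phi> ^\<^sub>m j) = n"
    using pow_carrier_mat[OF \<Phi>, of j] by (auto simp: carrier_matD)
  have "cmod (mtrace (\<Phi> ^\<^sub>m j)) \<le> (\<Sum>i<n. cmod ((\<Phi> ^\<^sub>m j) $$ (i, i)))"
    unfolding mtrace_def dim by (rule norm_sum)
  also have "\<dots> \<le> (\<Sum>i<n. mat_op_norm \<Phi> ^ j)"
    by (intro sum_mono pow_mat_entry_le[OF \<Phi>]) auto
  finally show ?thesis by simp
qed

text \<open>The sum of $|a_j| \<rho>^j$ over the coefficients $a_j$. It is submultiplicative, which allows polynomial determinants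
to be estimated in the same way as numerical ones, and with the operator norm for $\<rho>$ it bounds the
entries of the polynomial evaluated at a matrix.\<close>

definition poly_norm :: "real \<Rightarrow> complex poly \<Rightarrow> real" where
  "poly_norm \<rho> q = poly (map_poly cmod q) \<rho>"

lemma poly_norm_0 [simp]: "poly_norm \<rho> 0 = 0"
  by (simp add: poly_norm_def)

lemma poly_norm_pCons [simp]: "poly_norm \<rho> (pCons a q) = cmod a + \<rho> * poly_norm \<rho> q"
  by (simp add: poly_norm_def Polynomial.map_poly_pCons)

lemma poly_norm_nonneg: "\<rho> \<ge> 0 \<Longrightarrow> poly_norm \<rho> q \<ge> 0"
  by (induction q) auto

lemma poly_norm_uminus: "poly_norm \<rho> (- q) = poly_norm \<rho> q"
  by (induction q) auto

lemma poly_norm_add: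
  assumes "\<rho> \<ge> 0"
  shows "poly_norm \<rho> (p + q) \<le> poly_norm \<rho> p + poly_norm \<rho> q"
proof (induction p q rule: poly_induct2)
  case (pCons a p b q)
  have "\<rho> * poly_norm \<rho> (p + q) \<le> \<rho> * (poly_norm \<rho> p + poly_norm \<rho> q)"
    using pCons assms by (intro mult_left_mono) auto
  moreover have "cmod (a + b) \<le> cmod a + cmod b" by (rule norm_triangle_ineq)
  ultimately show ?case by (simp add: distrib_left)
qed auto

lemma poly_norm_smult: "poly_norm \<rho> (Polynomial.smult c q) = cmod c * poly_norm \<rho> q"
  by (induction q) (auto simp: norm_mult algebra_simps)

lemma poly_norm_mult:
  assumes "\<rho> \<ge> 0"
  shows "poly_norm \<rho> (p * q) \<le> poly_norm \<rho> p * poly_norm \<rho> q"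
proof (induction p)
  case (pCons a p)
  have "poly_norm \<rho> (pCons a p * q) \<le> poly_norm \<rho> (Polynomial.smult a q) + poly_norm \<rho> (pCons 0 (p * q))"
    unfolding mult_pCons_left by (rule poly_norm_add[OF assms])
  also have "\<dots> \<le> cmod a * poly_norm \<rho> q + \<rho> * (poly_norm \<rho> p * poly_norm \<rho> q)"
    using pCons assms by (auto simp: poly_norm_smult intro!: mult_left_mono)
  finally show ?case by (simp add: algebra_simps)
qed auto

lemma poly_norm_monom: "poly_norm \<rho> (monom c s) = cmod c * \<rho> ^ s"
  by (induction s) (auto simp: monom_0 monom_Suc)

lemma poly_norm_sum:
  assumes "\<rho> \<ge> 0"
  shows "poly_norm \<rho> (\<Sum>i\<in>I. f i) \<le> (\<Sum>i\<in>I. poly_norm \<rho> (f i))"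
proof (induction I rule: infinite_finite_induct)
  case (insert i I)
  then show ?case using poly_norm_add[OF assms, of "f i" "\<Sum>i\<in>I. f i"] by simp
qed auto

lemma poly_mat_entry_le:
  assumes \<Phi>: "\<Phi> \<in> carrier_mat n n" and uv: "u < n" "v < n"
  shows "cmod (poly_mat q \<Phi> $$ (u, v)) \<le> poly_norm (mat_op_norm \<Phi>) q"
proof -
  have "cmod (poly_mat q \<Phi> $$ (u, v)) \<le> (\<Sum>j\<le>degree q. cmod (poly.coeff q j * (\<Phi> ^\<^sub>m j) $$ (u, v)))"
    unfolding poly_mat_index[OF \<Phi> uv order.refl] by (rule norm_sum)
  also have "\<dots> \<le> (\<Sum>j\<le>degree q. cmod (poly.coeff q j) * mat_op_norm \<Phi> ^ j)"
    unfolding norm_mult by (intro sum_mono mult_left_mono pow_mat_entry_le[OF \<Phi> uv]) auto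
  also have "\<dots> = poly_norm (mat_op_norm \<Phi>) q"
    unfolding poly_norm_def poly_altdef by (simp add: degree_map_poly coeff_map_poly)
  finally show ?thesis .
qed

text \<open>The Leibniz formula. The factors $x_i y_j$ record the weights of rows and columns: for a Hankel matrix the
entry at $(i, j)$ has degree $i + j$ up to a constant, and every term of the expansion then has the same degree.\<close>

lemma det_norm_le:
  fixes N :: "'a::comm_ring_1 \<Rightarrow> real" and E :: "nat \<Rightarrow> nat \<Rightarrow> 'a"
  assumes nonneg: "\<And>x. N x \<ge> 0" and zero: "N 0 = 0" and one: "N 1 \<le> 1" and neg: "\<And>x. N (- x) = N x"
    and add: "\<And>x y. N (x + y) \<le> N x + N y" and mult: "\<And>x y. N (x * y) \<le> N x * N y"
    and E: "\<And>i j. i < r \<Longrightarrow> j < r \<Longrightarrow> N (E i j) \<le> c * x i * y j"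
  shows "N (Determinant.det (Matrix.mat r r (\<lambda>(i, j). E i j)))
    \<le> fact r * (c ^ r * (\<Prod>i = 0..<r. x i) * (\<Prod>j = 0..<r. y j))"
proof -
  have sum: "N (\<Sum>i\<in>I. f i) \<le> (\<Sum>i\<in>I. N (f i))" for f :: "'b \<Rightarrow> 'a" and I
  proof (induction I rule: infinite_finite_induct)
    case (insert i I)
    then show ?case using add[of "f i" "\<Sum>i\<in>I. f i"] by simp
  qed (auto simp: zero)
  have prod: "N (\<Prod>i\<in>I. f i) \<le> (\<Prod>i\<in>I. N (f i))" for f :: "'b \<Rightarrow> 'a" and I
  proof (induction I rule: infinite_finite_induct)
    case (insert i I)
    then have "N (f i) * N (\<Prod>i\<in>I. f i) \<le> N (f i) * (\<Prod>i\<in>I. N (f i))"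
      by (intro mult_left_mono nonneg) auto
    then show ?case using insert mult[of "f i" "\<Prod>i\<in>I. f i"] by simp
  qed (auto simp: one)
  have sgn: "N (signof p * z) = N z" for p :: "nat \<Rightarrow> nat" and z
    by (cases "sign p = 1") (auto simp: sign_def neg)
  have "Determinant.det (Matrix.mat r r (\<lambda>(i, j). E i j))
     = (\<Sum>p | p permutes {0..<r}. signof p * (\<Prod>i = 0..<r. E i (p i)))"
  proof (subst det_def'[of _ r])
    have "(\<Prod>i = 0..<r. Matrix.mat r r (\<lambda>(i, j). E i j) $$ (i, p i)) = (\<Prod>i = 0..<r. E i (p i))"
      if "p permutes {0..<r}" for p
      using permutes_in_image[OF that] by (intro prod.cong) auto
    then show "(\<Sum>p | p permutes {0..<r}. signof p * (\<Prod>i = 0..<r. Matrix.mat r r (\<lambda>(i, j). E i j) $$ (i, p i)))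
      = (\<Sum>p | p permutes {0..<r}. signof p * (\<Prod>i = 0..<r. E i (p i)))"
      by (intro sum.cong) auto
  qed auto
  also have "N \<dots> \<le> (\<Sum>p | p permutes {0..<r}. N (\<Prod>i = 0..<r. E i (p i)))"
    by (rule order.trans[OF sum]) (simp add: sgn)
  also have "\<dots> \<le> (\<Sum>p | p permutes {0..<r}. c ^ r * (\<Prod>i = 0..<r. x i) * (\<Prod>j = 0..<r. y j))"
  proof (rule sum_mono)
    fix p assume "p \<in> {p. p permutes {0..<r}}"
    then have p: "p permutes {0..<r}" by simp
    have pi: "p i < r" if "i < r" for i using permutes_in_image[OF p, of i] that by simp
    have "N (\<Prod>i = 0..<r. E i (p i)) \<le> (\<Prod>i = 0..<r. N (E i (p i)))" by (rule prod)
    also have "\<dots> \<le> (\<Prod>i = 0..<r. c * x i * y (p i))"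
      by (intro prod_mono) (auto simp: nonneg intro!: E pi)
    also have "\<dots> = c ^ r * (\<Prod>i = 0..<r. x i) * (\<Prod>i = 0..<r. y (p i))"
      by (simp add: prod.distrib)
    also have "(\<Prod>i = 0..<r. y (p i)) = (\<Prod>j = 0..<r. y j)"
      using prod.permute[OF p, of y] by (simp add: o_def)
    finally show "N (\<Prod>i = 0..<r. E i (p i)) \<le> c ^ r * (\<Prod>i = 0..<r. x i) * (\<Prod>j = 0..<r. y j)" .
  qed
  also have "\<dots> = fact r * (c ^ r * (\<Prod>i = 0..<r. x i) * (\<Prod>j = 0..<r. y j))"
    by (simp add: card_permutations)
  finally show ?thesis .
qed

lemma det_cmod_le:
  fixes E :: "nat \<Rightarrow> nat \<Rightarrow> complex"
  assumes "\<And>i j. i < r \<Longrightarrow> j < r \<Longrightarrow> cmod (E i j) \<le> c * x i * y j"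
  shows "cmod (Determinant.det (Matrix.mat r r (\<lambda>(i, j). E i j)))
    \<le> fact r * (c ^ r * (\<Prod>i = 0..<r. x i) * (\<Prod>j = 0..<r. y j))"
  by (rule det_norm_le) (use assms in \<open>auto simp: norm_mult norm_triangle_ineq\<close>)

lemma det_poly_norm_le:
  fixes E :: "nat \<Rightarrow> nat \<Rightarrow> complex poly"
  assumes "\<rho> \<ge> 0" "\<And>i j. i < r \<Longrightarrow> j < r \<Longrightarrow> poly_norm \<rho> (E i j) \<le> c * x i * y j"
  shows "poly_norm \<rho> (Determinant.det (Matrix.mat r r (\<lambda>(i, j). E i j)))
    \<le> fact r * (c ^ r * (\<Prod>i = 0..<r. x i) * (\<Prod>j = 0..<r. y j))"
  by (rule det_norm_le)
    (use assms in \<open>auto simp: poly_norm_mult poly_norm_add poly_norm_uminus poly_norm_nonneg one_pCons\<close>)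

lemma fact_mult_power_le:
  assumes "M \<le> n" "n \<ge> 1"
  shows "fact M * real n ^ M \<le> real n ^ (2 * n)"
proof -
  have "(fact M :: real) \<le> real M ^ M"
    using fact_le_power[of M, where 'a=real] by simp
  also have "\<dots> \<le> real n ^ M" using assms by (intro power_mono) auto
  finally have "fact M * real n ^ M \<le> real n ^ M * real n ^ M" by (intro mult_right_mono) auto
  also have "\<dots> = real n ^ (M + M)" by (simp add: power_add)
  also have "\<dots> \<le> real n ^ (2 * n)" using assms by (intro power_increasing) auto
  finally show ?thesis .
qed

lemma hankel_exponent: "(\<Prod>i = 0..<M. R ^ i) * (\<Prod>j = 0..<M. R ^ j) = (R::real) ^ (M * (M - 1))"
proof -
  have "(\<Prod>i = 0..<M. R ^ i) = R ^ (\<Sum>i = 0..<M. i)" by (simp add: power_sum)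
  then have "(\<Prod>i = 0..<M. R ^ i) * (\<Prod>j = 0..<M. R ^ j) = R ^ (2 * (\<Sum>i = 0..<M. i))"
    by (simp add: mult_2 power_add)
  also have "2 * (\<Sum>i = 0..<M. i) = M * (M - 1)"
    by (induction M) (auto simp: algebra_simps)
  finally show ?thesis .
qed

text \<open>In all estimates powers of two are absorbed by using $2 ||\<Phi>||$ in place of $||\<Phi>||$; the remaining constants
are powers of $n$. The exponent is the degree of homogeneity.\<close>

lemma hankel_disc_le:
  assumes \<Phi>: "\<Phi> \<in> carrier_mat n n" and M: "M \<le> n" "n \<ge> 1"
  shows "cmod (hankel_disc M \<Phi>) \<le> real n ^ (2 * n) * (2 * mat_op_norm \<Phi>) ^ (M * (M - 1))"
proof -
  let ?\<rho> = "mat_op_norm \<Phi>" let ?R = "2 * ?\<rho>"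
  have \<rho>: "?\<rho> \<ge> 0" by (rule mat_op_norm_nonneg[OF \<Phi>])
  have "cmod (hankel_disc M \<Phi>) \<le> fact M * (real n ^ M * (\<Prod>i = 0..<M. ?R ^ i) * (\<Prod>j = 0..<M. ?R ^ j))"
    unfolding hankel_disc_def
  proof (rule det_cmod_le)
    fix i j
    have "?\<rho> ^ (i + j) \<le> ?R ^ (i + j)" using \<rho> by (intro power_mono) auto
    then have "real n * ?\<rho> ^ (i + j) \<le> real n * ?R ^ (i + j)" by (intro mult_left_mono) auto
    then show "cmod (mtrace (\<Phi> ^\<^sub>m (i + j))) \<le> real n * ?R ^ i * ?R ^ j"
      using mtrace_pow_le[OF \<Phi>, of "i + j"] by (simp add: power_add mult.assoc)
  qed
  also have "\<dots> = (fact M * real n ^ M) * ?R ^ (M * (M - 1))"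
    using hankel_exponent[of ?R M] by (simp add: mult.assoc)
  also have "\<dots> \<le> real n ^ (2 * n) * ?R ^ (M * (M - 1))"
    using fact_mult_power_le[OF M] \<rho> by (intro mult_right_mono) auto
  finally show ?thesis .
qed

text \<open>The binomial coefficients add up to $2^k$, which is why the doubled norm is convenient.\<close>

lemma shifted_trace_poly_norm_le:
  assumes \<Phi>: "\<Phi> \<in> carrier_mat n n"
  shows "poly_norm (mat_op_norm \<Phi>) (shifted_trace_poly k m \<Phi>)
    \<le> real n * (2 * mat_op_norm \<Phi>) ^ (k + m)"
proof -
  let ?\<rho> = "mat_op_norm \<Phi>"
  have \<rho>: "?\<rho> \<ge> 0" by (rule mat_op_norm_nonneg[OF \<Phi>])
  have "poly_norm ?\<rho> (shifted_trace_poly k m \<Phi>)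
      \<le> (\<Sum>s\<le>k. real (k choose s) * cmod (mtrace (\<Phi> ^\<^sub>m (k - s + m))) * ?\<rho> ^ s)"
    unfolding shifted_trace_poly_def
    by (rule order.trans[OF poly_norm_sum[OF \<rho>]]) (simp add: poly_norm_monom norm_mult norm_power)
  also have "\<dots> \<le> (\<Sum>s\<le>k. real (k choose s) * (real n * ?\<rho> ^ (k - s + m)) * ?\<rho> ^ s)"
    using \<rho> by (intro sum_mono mult_right_mono mult_left_mono mtrace_pow_le[OF \<Phi>]) auto
  also have "\<dots> = (\<Sum>s\<le>k. real (k choose s) * (real n * ?\<rho> ^ (k + m)))"
  proof (intro sum.cong refl)
    fix s assume "s \<in> {..k}"
    then have "?\<rho> ^ (k - s + m) * ?\<rho> ^ s = ?\<rho> ^ (k + m)" by (simp add: power_add[symmetric])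
    then show "real (k choose s) * (real n * ?\<rho> ^ (k - s + m)) * ?\<rho> ^ s
      = real (k choose s) * (real n * ?\<rho> ^ (k + m))" by (simp add: mult.assoc)
  qed
  also have "\<dots> = real (\<Sum>s\<le>k. k choose s) * (real n * ?\<rho> ^ (k + m))"
    by (simp only: of_nat_sum sum_distrib_right)
  also have "\<dots> = 2 ^ k * (real n * ?\<rho> ^ (k + m))"
    unfolding choose_row_sum by simp
  also have "\<dots> \<le> 2 ^ (k + m) * (real n * ?\<rho> ^ (k + m))"
    using \<rho> by (intro mult_right_mono power_increasing) auto
  finally show ?thesis by (simp add: power_mult_distrib mult_ac)
qed

lemma hankel_mat_entry_le:
  assumes \<Phi>: "\<Phi> \<in> carrier_mat n n" and M: "M \<le> n" "n \<ge> 1" and uv: "u < n" "v < n"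
  shows "cmod (hankel_mat M k \<Phi> $$ (u, v))
    \<le> real n ^ (2 * n) * (2 * mat_op_norm \<Phi>) ^ (M * (M - 1) + k * M)"
proof -
  let ?\<rho> = "mat_op_norm \<Phi>" let ?R = "2 * ?\<rho>"
  have \<rho>: "?\<rho> \<ge> 0" by (rule mat_op_norm_nonneg[OF \<Phi>])
  have "cmod (hankel_mat M k \<Phi> $$ (u, v)) \<le> poly_norm ?\<rho> (hankel_poly M k \<Phi>)"
    unfolding hankel_mat_def by (rule poly_mat_entry_le[OF \<Phi> uv])
  also have "\<dots> \<le> fact M * ((real n * ?R ^ k) ^ M * (\<Prod>i = 0..<M. ?R ^ i) * (\<Prod>j = 0..<M. ?R ^ j))"
    unfolding hankel_poly_def
  proof (rule det_poly_norm_le[OF \<rho>])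
    fix i j
    show "poly_norm ?\<rho> (shifted_trace_poly k (i + j) \<Phi>) \<le> real n * ?R ^ k * ?R ^ i * ?R ^ j"
      using shifted_trace_poly_norm_le[OF \<Phi>, of k "i + j"] by (simp only: power_add mult.assoc)
  qed
  also have "\<dots> = (fact M * real n ^ M) * ?R ^ (M * (M - 1) + k * M)"
    unfolding power_add hankel_exponent[symmetric]
    unfolding power_mult power_mult_distrib[of "real n"]
    by (simp only: mult_ac)
  also have "\<dots> \<le> real n ^ (2 * n) * ?R ^ (M * (M - 1) + k * M)"
    using fact_mult_power_le[OF M] \<rho> by (intro mult_right_mono) auto
  finally show ?thesis .
qed

lemma hankel_minor_le:
  assumes \<Phi>: "\<Phi> \<in> carrier_mat n n" and M: "M \<le> n" "n \<ge> 1" and r: "r \<le> n"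
    and f: "\<And>i. i < r \<Longrightarrow> f i < n" and g: "\<And>i. i < r \<Longrightarrow> g i < n"
  shows "cmod (minor (hankel_mat M k \<Phi>) r f g)
    \<le> real n ^ (n + 2 * n ^ 2) * (2 * mat_op_norm \<Phi>) ^ (r * (M * (M - 1) + k * M))"
proof -
  let ?R = "2 * mat_op_norm \<Phi>" let ?e = "M * (M - 1) + k * M"
  have \<rho>: "mat_op_norm \<Phi> \<ge> 0" by (rule mat_op_norm_nonneg[OF \<Phi>])
  have "cmod (minor (hankel_mat M k \<Phi>) r f g)
      \<le> fact r * ((real n ^ (2 * n) * ?R ^ ?e) ^ r * (\<Prod>i = 0..<r. 1) * (\<Prod>j = 0..<r. 1))"
    unfolding minor_def
    by (rule det_cmod_le) (use hankel_mat_entry_le[OF \<Phi> M f g] in auto)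
  also have "\<dots> = (fact r * (real n ^ (2 * n)) ^ r) * ?R ^ (r * ?e)"
    by (simp add: power_mult_distrib power_mult[symmetric] mult_ac)
  also have "\<dots> \<le> real n ^ (n + 2 * n ^ 2) * ?R ^ (r * ?e)"
  proof (intro mult_right_mono)
    have "(fact r :: real) \<le> real r ^ r"
      using fact_le_power[of r, where 'a=real] by simp
    also have "\<dots> \<le> real n ^ r" using r by (intro power_mono) auto
    also have "\<dots> \<le> real n ^ n" using r M by (intro power_increasing) auto
    finally have 1: "(fact r :: real) \<le> real n ^ n" .
    have "(real n ^ (2 * n)) ^ r = real n ^ (2 * n * r)" by (simp add: power_mult)
    also have "\<dots> \<le> real n ^ (2 * n * n)" using r M by (intro power_increasing) auto
    finally have 2: "(real n ^ (2 * n)) ^ r \<le> real n ^ (2 * n ^ 2)" by (simp add: power2_eq_square mult.assoc)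
    show "fact r * (real n ^ (2 * n)) ^ r \<le> real n ^ (n + 2 * n ^ 2)"
      unfolding power_add using 1 2 by (intro mult_mono) auto
  qed (use \<rho> in auto)
  finally show ?thesis .
qed

section \<open>Holomorphic functions of several variables\<close>

lemma has_derivative_complex_line:
  fixes z u :: "complex ^ 'N"
  shows "((\<lambda>t. z + t *s u) has_derivative (\<lambda>h. h *s u)) (at t)"
proof -
  have "linear (\<lambda>t::complex. t *s u)"
    by (rule linearI; unfold Finite_Cartesian_Product.vec_eq_iff; simp add: distrib_right)
  then have "bounded_linear (\<lambda>t::complex. t *s u)"
    by (simp add: linear_conv_bounded_linear)
  from bounded_linear_imp_has_derivative[OF this] show ?thesis
    by (auto intro!: derivative_eq_intros)
qed

text \<open>Restriction to the complex line through $z$ and $w$ reduces this to the identity theorem in one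
variable, on the convex set of parameters for which the line is inside the ball.\<close>

lemma holomorphic_sev_zero_on_ball:
  fixes f :: "complex ^ 'N \<Rightarrow> complex"
  assumes hol: "holomorphic_sev_on f (ball \<xi> r)" and Z: "open Z" "z \<in> Z" "z \<in> ball \<xi> r"
    and zero: "\<And>x. x \<in> Z \<Longrightarrow> f x = 0" and w: "w \<in> ball \<xi> r"
  shows "f w = 0"
proof -
  define u where "u = w - z"
  define L where "L t = z + t *s u" for t :: complex
  define S where "S = L -` ball \<xi> r"
  have contL: "continuous_on UNIV L"
    unfolding L_def using has_derivative_complex_line has_derivative_continuous
    by (metis continuous_at_imp_continuous_on)
  have openS: "open S" unfolding S_def by (intro open_vimage contL open_ball)
  have "convex S"
  proof (unfold convex_alt, intro ballI allI impI)
    fix s t a assume st: "s \<in> S" "t \<in> S" and a: "0 \<le> a \<and> a \<le> (1::real)"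
    have "L ((1 - a) *\<^sub>R s + a *\<^sub>R t) = (1 - a) *\<^sub>R L s + a *\<^sub>R L t"
      unfolding L_def Finite_Cartesian_Product.vec_eq_iff by (simp add: scaleR_conv_of_real[where 'a=complex] algebra_simps)
    moreover have "(1 - a) *\<^sub>R L s + a *\<^sub>R L t \<in> ball \<xi> r"
      using st a convex_ball[of \<xi> r] unfolding convex_alt S_def by auto
    ultimately show "(1 - a) *\<^sub>R s + a *\<^sub>R t \<in> S" unfolding S_def by simp
  qed
  then have connS: "connected S" by (rule convex_connected)
  have holS: "(f \<circ> L) holomorphic_on S"
    unfolding holomorphic_on_def
  proof
    fix t assume "t \<in> S"
    then have "L t \<in> ball \<xi> r" unfolding S_def by simp
    then obtain D where D: "(f has_derivative D) (at (L t))" "\<And>c v. D (c *s v) = c * D v"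
      using hol unfolding holomorphic_sev_on_def by blast
    have "(f \<circ> L has_derivative D \<circ> (\<lambda>h. h *s u)) (at t)"
      using diff_chain_at[of L "\<lambda>h. h *s u" t f D] D(1) has_derivative_complex_line
      unfolding L_def by auto
    moreover have "D \<circ> (\<lambda>h. h *s u) = (*) (D u)" using D(2) by (auto simp: mult.commute)
    ultimately have "(f \<circ> L has_field_derivative D u) (at t)"
      by (simp add: has_field_derivative_def)
    then show "(f \<circ> L) field_differentiable at t within S"
      using field_differentiable_at_within field_differentiable_def by blast
  qed
  have L0: "L 0 = z" and L1: "L 1 = w" unfolding L_def u_def by (auto simp: Finite_Cartesian_Product.vec_eq_iff)
  \<comment> \<open>An open set of parameters around 0 on which the restricted function vanishes.\<close>
  define U where "U = S \<inter> L -` Z"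
  have "open U" unfolding U_def by (intro open_Int openS open_vimage contL Z)
  moreover have "0 \<in> U" using Z L0 unfolding U_def S_def by simp
  ultimately have "0 islimpt U" by (metis interior_limit_point interior_open)
  then have "(f \<circ> L) 1 = 0"
  proof (rule analytic_continuation[OF holS openS connS, of U 0 1, rotated 2])
    show "(f \<circ> L) t = 0" if "t \<in> U" for t using that zero unfolding U_def by simp
  qed (use Z w L0 L1 in \<open>auto simp: U_def S_def\<close>)
  then show ?thesis using L1 by simp
qed

lemma holomorphic_sev_on_subset: "holomorphic_sev_on f X \<Longrightarrow> Y \<subseteq> X \<Longrightarrow> holomorphic_sev_on f Y"
  unfolding holomorphic_sev_on_def by blast

text \<open>The interior of the zero set is open; it is also relatively closed, since a ball that meets it
belongs to it by the preceding lemma.\<close>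

theorem holomorphic_sev_identity:
  fixes f :: "complex ^ 'N \<Rightarrow> complex"
  assumes X: "open X" "connected X" and hol: "holomorphic_sev_on f X"
    and U: "open U" "U \<noteq> {}" "U \<subseteq> X" and zero: "\<And>x. x \<in> U \<Longrightarrow> f x = 0"
    and w: "w \<in> X"
  shows "f w = 0"
proof -
  define Z where "Z = interior {x \<in> X. f x = 0}"
  have oZ: "open Z" unfolding Z_def by simp
  have ZX: "Z \<subseteq> X" unfolding Z_def using interior_subset by blast
  have Z0: "f x = 0" if "x \<in> Z" for x using that interior_subset unfolding Z_def by blast
  have "U \<subseteq> Z" unfolding Z_def using U zero by (intro interior_maximal) auto
  then have Zne: "Z \<noteq> {}" using U by auto
  have "open (X - Z)"
  proof (subst open_subopen, intro ballI)
    fix \<xi> assume \<xi>: "\<xi> \<in> X - Z"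
    then obtain r where r: "r > 0" "ball \<xi> r \<subseteq> X" using X(1) open_contains_ball by blast
    have "ball \<xi> r \<inter> Z = {}"
    proof (rule ccontr)
      assume "ball \<xi> r \<inter> Z \<noteq> {}"
      then obtain z where z: "z \<in> Z" "z \<in> ball \<xi> r" by auto
      have "f x = 0" if "x \<in> ball \<xi> r" for x
        by (rule holomorphic_sev_zero_on_ball[OF holomorphic_sev_on_subset[OF hol r(2)] oZ z Z0 that])
      then have "ball \<xi> r \<subseteq> Z" unfolding Z_def using r by (intro interior_maximal) auto
      moreover have "\<xi> \<in> ball \<xi> r" using r(1) by simp
      ultimately show False using \<xi> by blast
    qed
    then show "\<exists>T. open T \<and> \<xi> \<in> T \<and> T \<subseteq> X - Z" using r by (intro exI[of _ "ball \<xi> r"]) auto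
  qed
  then have "X - Z = {}"
    using connectedD[OF X(2) oZ \<open>open (X - Z)\<close>] Zne ZX by auto
  then show ?thesis using Z0 w by auto
qed

text \<open>The class of functions from which the defining equations are built: a ring, closed under the
polynomial operations applied to the entries of the family.\<close>

definition regular_on :: "(complex ^ 'N) set \<Rightarrow> (complex ^ 'N \<Rightarrow> complex) \<Rightarrow> bool" where
  "regular_on X f \<longleftrightarrow> continuous_on (closure X) f \<and> holomorphic_sev_on f X"

lemma regular_on_const: "regular_on X (\<lambda>_. c)"
  unfolding regular_on_def holomorphic_sev_on_def
  by (auto intro!: exI[of _ "\<lambda>_. 0"])

lemma regular_on_add:
  assumes "regular_on X f" "regular_on X g"
  shows "regular_on X (\<lambda>z. f z + g z)"
proof -
  have "\<exists>D. ((\<lambda>z. f z + g z) has_derivative D) (at z) \<and> (\<forall>c v. D (c *s v) = c * D v)" if zX: "z \<in> X" for z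
  proof -
    obtain D where D: "(f has_derivative D) (at z)" "\<forall>c v. D (c *s v) = c * D v"
      using assms(1) zX unfolding regular_on_def holomorphic_sev_on_def by auto
    obtain E where E: "(g has_derivative E) (at z)" "\<forall>c v. E (c *s v) = c * E v"
      using assms(2) zX unfolding regular_on_def holomorphic_sev_on_def by auto
    show ?thesis using D E
      by (intro exI[of _ "\<lambda>v. D v + E v"]) (auto intro: has_derivative_add simp: distrib_left)
  qed
  then show ?thesis using assms unfolding regular_on_def holomorphic_sev_on_def
    by (auto intro: continuous_intros)
qed

lemma regular_on_mult:
  assumes "regular_on X f" "regular_on X g"
  shows "regular_on X (\<lambda>z. f z * g z)"
proof -
  have "\<exists>D. ((\<lambda>z. f z * g z) has_derivative D) (at z) \<and> (\<forall>c v. D (c *s v) = c * D v)" if zX: "z \<in> X" for z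
  proof -
    obtain D where D: "(f has_derivative D) (at z)" "\<forall>c v. D (c *s v) = c * D v"
      using assms(1) zX unfolding regular_on_def holomorphic_sev_on_def by auto
    obtain E where E: "(g has_derivative E) (at z)" "\<forall>c v. E (c *s v) = c * E v"
      using assms(2) zX unfolding regular_on_def holomorphic_sev_on_def by auto
    show ?thesis using D E
      by (intro exI[of _ "\<lambda>v. f z * E v + D v * g z"])
        (intro conjI has_derivative_mult, simp_all add: algebra_simps)
  qed
  then show ?thesis using assms unfolding regular_on_def holomorphic_sev_on_def
    by (auto intro: continuous_intros)
qed

lemma regular_on_uminus: "regular_on X f \<Longrightarrow> regular_on X (\<lambda>z. - f z)"
  using regular_on_mult[OF regular_on_const[of X "-1"]] by simp

lemma regular_on_diff: "regular_on X f \<Longrightarrow> regular_on X g \<Longrightarrow> regular_on X (\<lambda>z. f z - g z)"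
  using regular_on_add[OF _ regular_on_uminus] by fastforce

lemma regular_on_sum: "(\<And>i. i \<in> I \<Longrightarrow> regular_on X (f i)) \<Longrightarrow> regular_on X (\<lambda>z. \<Sum>i\<in>I. f i z)"
  by (induction I rule: infinite_finite_induct) (auto intro: regular_on_const regular_on_add)

lemma regular_on_prod: "(\<And>i. i \<in> I \<Longrightarrow> regular_on X (f i)) \<Longrightarrow> regular_on X (\<lambda>z. \<Prod>i\<in>I. f i z)"
  by (induction I rule: infinite_finite_induct) (auto intro: regular_on_const regular_on_mult)

lemma regular_on_power: "regular_on X f \<Longrightarrow> regular_on X (\<lambda>z. f z ^ k)"
  by (induction k) (auto intro: regular_on_const regular_on_mult)

lemma regular_on_cong:
  assumes X: "open X" and f: "regular_on X f" and eq: "\<And>z. z \<in> closure X \<Longrightarrow> f z = g z"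
  shows "regular_on X g"
proof -
  have "\<exists>D. (g has_derivative D) (at z) \<and> (\<forall>c v. D (c *s v) = c * D v)" if z: "z \<in> X" for z
  proof -
    obtain D where D: "(f has_derivative D) (at z)" "\<forall>c v. D (c *s v) = c * D v"
      using f z unfolding regular_on_def holomorphic_sev_on_def by blast
    have "(g has_derivative D) (at z)"
      by (rule has_derivative_transform_within_open[OF D(1) X z]) (use eq closure_subset in auto)
    then show ?thesis using D(2) by blast
  qed
  moreover have "continuous_on (closure X) g"
    using f eq continuous_on_cong[of "closure X" "closure X" f g] unfolding regular_on_def by auto
  ultimately show ?thesis unfolding regular_on_def holomorphic_sev_on_def by blast
qed

text \<open>Density up to the boundary holds because an open set that meets the closure of $X$ meets $X$; a
function vanishing on $X$ vanishes on the closure by continuity.\<close>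

lemma regular_on_nonzero_dense:
  assumes X: "open X" "connected X" and f: "regular_on X f"
    and z: "z \<in> closure X" "f z \<noteq> 0"
    and W: "open W" "W \<inter> closure X \<noteq> {}"
  obtains w where "w \<in> W" "w \<in> X" "f w \<noteq> 0"
proof -
  have WX: "W \<inter> X \<noteq> {}" using W open_Int_closure_eq_empty by blast
  have "\<exists>w\<in>W \<inter> X. f w \<noteq> 0"
  proof (rule ccontr)
    assume "\<not> (\<exists>w\<in>W \<inter> X. f w \<noteq> 0)"
    then have zero: "\<And>w. w \<in> W \<inter> X \<Longrightarrow> f w = 0" by blast
    have "f w = 0" if "w \<in> X" for w
      by (rule holomorphic_sev_identity[OF X _ _ WX _ zero that])
        (use f X W in \<open>auto simp: regular_on_def\<close>)
    then have "f z = 0"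
      using continuous_constant_on_closure[of X f 0 z] f z(1) unfolding regular_on_def by auto
    with z(2) show False ..
  qed
  then show ?thesis using that by blast
qed

text \<open>A determinant is a polynomial in its entries. The closure property is left abstract since it is used
for scalar functions and for functions with polynomial values.\<close>

lemma det_closure:
  fixes E :: "nat \<Rightarrow> nat \<Rightarrow> 'z \<Rightarrow> 'a::comm_ring_1" and C :: "('z \<Rightarrow> 'a) \<Rightarrow> bool"
  assumes zero: "C (\<lambda>_. 0)" and one: "C (\<lambda>_. 1)" and neg: "\<And>f. C f \<Longrightarrow> C (\<lambda>z. - f z)"
    and add: "\<And>f g. C f \<Longrightarrow> C g \<Longrightarrow> C (\<lambda>z. f z + g z)"
    and mult: "\<And>f g. C f \<Longrightarrow> C g \<Longrightarrow> C (\<lambda>z. f z * g z)"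
    and E: "\<And>i j. i < r \<Longrightarrow> j < r \<Longrightarrow> C (E i j)"
  shows "C (\<lambda>z. Determinant.det (Matrix.mat r r (\<lambda>(i, j). E i j z)))"
proof -
  have sum: "(\<And>i. i \<in> I \<Longrightarrow> C (f i)) \<Longrightarrow> C (\<lambda>z. \<Sum>i\<in>I. f i z)" for I and f :: "'b \<Rightarrow> 'z \<Rightarrow> 'a"
    by (induction I rule: infinite_finite_induct) (auto intro: zero add)
  have prod: "(\<And>i. i \<in> I \<Longrightarrow> C (f i)) \<Longrightarrow> C (\<lambda>z. \<Prod>i\<in>I. f i z)" for I and f :: "'b \<Rightarrow> 'z \<Rightarrow> 'a"
    by (induction I rule: infinite_finite_induct) (auto intro: one mult)
  have "Determinant.det (Matrix.mat r r (\<lambda>(i, j). E i j z))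
     = (\<Sum>p | p permutes {0..<r}. signof p * (\<Prod>i = 0..<r. E i (p i) z))" for z
  proof (subst det_def'[of _ r])
    have "(\<Prod>i = 0..<r. Matrix.mat r r (\<lambda>(i, j). E i j z) $$ (i, p i)) = (\<Prod>i = 0..<r. E i (p i) z)"
      if "p permutes {0..<r}" for p
      using permutes_in_image[OF that] by (intro prod.cong) auto
    then show "(\<Sum>p | p permutes {0..<r}. signof p * (\<Prod>i = 0..<r. Matrix.mat r r (\<lambda>(i, j). E i j z) $$ (i, p i)))
      = (\<Sum>p | p permutes {0..<r}. signof p * (\<Prod>i = 0..<r. E i (p i) z))"
      by (intro sum.cong) auto
  qed auto
  moreover have "C (\<lambda>z. \<Sum>p | p permutes {0..<r}. signof p * (\<Prod>i = 0..<r. E i (p i) z))"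
  proof (intro sum)
    fix p assume "p \<in> {p. p permutes {0..<r}}"
    then have pi: "p i < r" if "i < r" for i using permutes_in_image[of p "{0..<r}" i] that by simp
    have P: "C (\<lambda>z. \<Prod>i = 0..<r. E i (p i) z)"
      by (rule prod) (use E pi in auto)
    then show "C (\<lambda>z. signof p * (\<Prod>i = 0..<r. E i (p i) z))"
      using neg[OF P] by (cases "sign p = 1") (auto simp: sign_def)
  qed
  ultimately show ?thesis by simp
qed

text \<open>The uniform bound on the degree matters: evaluating the polynomials at the matrices $A(z)$ is then a sum
over an index set that does not depend on $z$.\<close>

definition regular_poly_on :: "(complex ^ 'N) set \<Rightarrow> (complex ^ 'N \<Rightarrow> complex poly) \<Rightarrow> bool" where
  "regular_poly_on X q \<longleftrightarrow>
     (\<exists>N. \<forall>z. degree (q z) \<le> N) \<and> (\<forall>s. regular_on X (\<lambda>z. poly.coeff (q z) s))"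

lemma regular_poly_on_const: "regular_poly_on X (\<lambda>_. c)"
  unfolding regular_poly_on_def by (auto intro: regular_on_const)

lemma regular_poly_on_add:
  assumes "regular_poly_on X p" "regular_poly_on X q"
  shows "regular_poly_on X (\<lambda>z. p z + q z)"
proof -
  obtain M N where "\<forall>z. degree (p z) \<le> M" "\<forall>z. degree (q z) \<le> N"
    using assms unfolding regular_poly_on_def by blast
  then have "\<forall>z. degree (p z + q z) \<le> max M N"
    by (meson degree_add_le max.cobounded1 max.cobounded2 order.trans)
  then show ?thesis using assms unfolding regular_poly_on_def by (auto intro: regular_on_add)
qed

lemma regular_poly_on_uminus:
  "regular_poly_on X p \<Longrightarrow> regular_poly_on X (\<lambda>z. - p z)"
  unfolding regular_poly_on_def by (auto intro: regular_on_uminus)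

lemma regular_poly_on_mult:
  assumes "regular_poly_on X p" "regular_poly_on X q"
  shows "regular_poly_on X (\<lambda>z. p z * q z)"
proof -
  obtain M N where MN: "\<forall>z. degree (p z) \<le> M" "\<forall>z. degree (q z) \<le> N"
    using assms unfolding regular_poly_on_def by blast
  have "degree (p z * q z) \<le> M + N" for z
    using degree_mult_le[of "p z" "q z"] MN by (meson add_mono order.trans)
  then show ?thesis using assms unfolding regular_poly_on_def coeff_mult
    by (auto intro!: regular_on_sum regular_on_mult)
qed

lemma regular_poly_on_monom:
  assumes "regular_on X f"
  shows "regular_poly_on X (\<lambda>z. monom (f z) s)"
proof -
  have "\<forall>z. degree (monom (f z) s) \<le> s" by (simp add: degree_monom_le)
  moreover have "regular_on X (\<lambda>z. poly.coeff (monom (f z) s) t)" for t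
    using assms by (cases "s = t") (auto intro: regular_on_const)
  ultimately show ?thesis unfolding regular_poly_on_def by blast
qed

lemma regular_poly_on_sum:
  "(\<And>i. i \<in> I \<Longrightarrow> regular_poly_on X (f i)) \<Longrightarrow> regular_poly_on X (\<lambda>z. \<Sum>i\<in>I. f i z)"
  by (induction I rule: infinite_finite_induct) (auto intro: regular_poly_on_const regular_poly_on_add)

locale regular_matrix =
  fixes X :: "(complex ^ 'N) set" and n :: nat and A :: "complex ^ 'N \<Rightarrow> complex mat"
  assumes open_X: "open X" and A_carrier: "\<And>z. z \<in> closure X \<Longrightarrow> A z \<in> carrier_mat n n"
    and A_regular: "\<And>i j. i < n \<Longrightarrow> j < n \<Longrightarrow> regular_on X (\<lambda>z. A z $$ (i, j))"
begin

lemma regular_pow_entry: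
  assumes "u < n" "v < n"
  shows "regular_on X (\<lambda>z. (A z ^\<^sub>m j) $$ (u, v))"
  using assms
proof (induction j arbitrary: v)
  case 0
  show ?case
    by (rule regular_on_cong[OF open_X regular_on_const[of _ "if u = v then 1 else 0"]])
      (use 0 A_carrier[THEN carrier_matD(1)] in auto)
next
  case (Suc j)
  have "regular_on X (\<lambda>z. \<Sum>l = 0..<n. (A z ^\<^sub>m j) $$ (u, l) * A z $$ (l, v))"
    by (intro regular_on_sum regular_on_mult Suc.IH A_regular) (use Suc.prems in auto)
  then show ?case
  proof (rule regular_on_cong[OF open_X])
    fix z assume "z \<in> closure X"
    then have C: "A z \<in> carrier_mat n n" by (rule A_carrier)
    have "dim_row (A z ^\<^sub>m j) = n" "dim_col (A z ^\<^sub>m j) = n"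
      using carrier_matD[OF pow_carrier_mat[OF C, of j]] by auto
    then show "(\<Sum>l = 0..<n. (A z ^\<^sub>m j) $$ (u, l) * A z $$ (l, v)) = (A z ^\<^sub>m Suc j) $$ (u, v)"
      using C Suc.prems by (simp add: scalar_prod_def del: pow_mat_dim)
  qed
qed

lemma regular_power_trace: "regular_on X (\<lambda>z. mtrace (A z ^\<^sub>m j))"
proof (rule regular_on_cong[OF open_X])
  show "regular_on X (\<lambda>z. \<Sum>i<n. (A z ^\<^sub>m j) $$ (i, i))"
    by (intro regular_on_sum regular_pow_entry) auto
  fix z assume "z \<in> closure X"
  then have C: "A z \<in> carrier_mat n n" by (rule A_carrier)
  show "(\<Sum>i<n. (A z ^\<^sub>m j) $$ (i, i)) = mtrace (A z ^\<^sub>m j)"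
    unfolding mtrace_def using carrier_matD(1)[OF pow_carrier_mat[OF C, of j]] by simp
qed

lemma regular_hankel_disc: "regular_on X (\<lambda>z. hankel_disc M (A z))"
  unfolding hankel_disc_def
  by (rule det_closure)
    (auto intro: regular_on_const regular_on_uminus regular_on_add regular_on_mult regular_power_trace)

lemma regular_hankel_poly: "regular_poly_on X (\<lambda>z. hankel_poly M k (A z))"
  unfolding hankel_poly_def
proof (rule det_closure)
  show "regular_poly_on X (\<lambda>z. shifted_trace_poly k (i + j) (A z))" for i j
    unfolding shifted_trace_poly_def
    by (intro regular_poly_on_sum regular_poly_on_monom regular_on_mult regular_on_const regular_power_trace)
qed (auto intro: regular_poly_on_const regular_poly_on_uminus regular_poly_on_add regular_poly_on_mult)

lemma regular_hankel_mat_entry: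
  assumes uv: "u < n" "v < n"
  shows "regular_on X (\<lambda>z. hankel_mat M k (A z) $$ (u, v))"
proof -
  obtain N where N: "\<And>z. degree (hankel_poly M k (A z)) \<le> N"
    and co: "\<And>s. regular_on X (\<lambda>z. poly.coeff (hankel_poly M k (A z)) s)"
    using regular_hankel_poly unfolding regular_poly_on_def by blast
  show ?thesis
  proof (rule regular_on_cong[OF open_X])
    show "regular_on X (\<lambda>z. \<Sum>j\<le>N. poly.coeff (hankel_poly M k (A z)) j * (A z ^\<^sub>m j) $$ (u, v))"
      by (intro regular_on_sum regular_on_mult co regular_pow_entry uv)
    show "(\<Sum>j\<le>N. poly.coeff (hankel_poly M k (A z)) j * (A z ^\<^sub>m j) $$ (u, v))
        = hankel_mat M k (A z) $$ (u, v)" if "z \<in> closure X" for z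
      unfolding hankel_mat_def by (rule poly_mat_index[OF A_carrier[OF that] uv N, symmetric])
  qed
qed

lemma regular_hankel_minor:
  assumes "\<And>i. i < r \<Longrightarrow> f i < n" "\<And>i. i < r \<Longrightarrow> g i < n"
  shows "regular_on X (\<lambda>z. minor (hankel_mat M k (A z)) r f g)"
  unfolding minor_def
  by (rule det_closure)
    (use assms in \<open>auto intro: regular_on_const regular_on_uminus regular_on_add regular_on_mult
      regular_hankel_mat_entry\<close>)

end

section \<open>The Jordan stable points of a holomorphic family\<close>

text \<open>Grouping the blocks by size shows that the ranks are functions of the block counts alone; the
eigenvalues to which the blocks belong do not matter.\<close>

lemma hankel_rank_eq_block_counts:
  assumes \<Phi>: "\<Phi> \<in> carrier_mat n n" and card: "card (spectrum \<Phi>) = M"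
  shows "hankel_rank M k \<Phi> = (\<Sum>l = 1..n. (l - k) * jordan_block_count l \<Phi>)"
proof -
  obtain n_as where jnf: "jordan_nf \<Phi> n_as" using complex_jordan_nf_exists[OF \<Phi>] .
  have "0 \<notin> fst ` set n_as" using jnf unfolding jordan_nf_def by auto
  moreover have "b \<le> n" if "b \<in> fst ` set n_as" for b
    using member_le_sum_list[of b "map fst n_as"] that jordan_nf_sum_sizes[OF \<Phi> jnf] by auto
  ultimately have "\<forall>(b, c)\<in>set n_as. b \<in> {1..n}" by (force simp: Suc_le_eq)
  then have "(\<Sum>(b, c)\<leftarrow>n_as. b - k) = (\<Sum>l = 1..n. (l - k) * length (filter (\<lambda>(b, c). b = l) n_as))"
  proof (induction n_as)
    case (Cons bc n_as)
    obtain b c where bc: "bc = (b, c)" by force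
    have "(\<Sum>l = 1..n. (l - k) * length (filter (\<lambda>(b, c). b = l) (bc # n_as)))
        = (\<Sum>l = 1..n. (if b = l then l - k else 0) + (l - k) * length (filter (\<lambda>(b, c). b = l) n_as))"
      by (intro sum.cong) (auto simp: bc)
    also have "\<dots> = (b - k) + (\<Sum>(b, c)\<leftarrow>n_as. b - k)"
      using Cons by (simp add: sum.distrib bc)
    finally show ?case by (simp add: bc)
  qed auto
  then show ?thesis
    unfolding hankel_rank_jordan_nf[OF \<Phi> jnf card] jordan_block_count_eq[OF jnf] .
qed

text \<open>Conversely the number of blocks of size $l$ is the second difference at $l$ of the
rank as a function of $k$, because $b - k$ (truncated at zero) is convex in $k$ with its only kink at $k = b$. The
values at $k = 0$ and $k = n + 1$, namely $n$ and $0$, are always the same.\<close>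

lemma block_counts_eq_iff_hankel_ranks_eq:
  assumes \<Phi>: "\<Phi> \<in> carrier_mat n n" "card (spectrum \<Phi>) = M"
    and \<Psi>: "\<Psi> \<in> carrier_mat n n" "card (spectrum \<Psi>) = M"
  shows "(\<forall>l\<in>{1..n}. jordan_block_count l \<Phi> = jordan_block_count l \<Psi>)
    \<longleftrightarrow> (\<forall>k\<in>{1..n}. hankel_rank M k \<Phi> = hankel_rank M k \<Psi>)"
proof
  assume "\<forall>l\<in>{1..n}. jordan_block_count l \<Phi> = jordan_block_count l \<Psi>"
  then show "\<forall>k\<in>{1..n}. hankel_rank M k \<Phi> = hankel_rank M k \<Psi>"
    unfolding hankel_rank_eq_block_counts[OF \<Phi>] hankel_rank_eq_block_counts[OF \<Psi>] by simp
next
  assume eq: "\<forall>k\<in>{1..n}. hankel_rank M k \<Phi> = hankel_rank M k \<Psi>"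
  \<comment> \<open>Truncated subtraction makes the rank vanish for k > n, since no block is larger than n.\<close>
  have diff: "hankel_rank M (l - 1) \<Theta> + hankel_rank M (l + 1) \<Theta>
      = 2 * hankel_rank M l \<Theta> + jordan_block_count l \<Theta>"
    and zero: "hankel_rank M 0 \<Theta> = n" and large: "hankel_rank M (n + 1) \<Theta> = 0"
    if \<Theta>: "\<Theta> \<in> carrier_mat n n" "card (spectrum \<Theta>) = M" and l: "l \<ge> 1" for \<Theta> l
  proof -
    obtain n_as where jnf: "jordan_nf \<Theta> n_as" using complex_jordan_nf_exists[OF \<Theta>(1)] .
    note r = hankel_rank_jordan_nf[OF \<Theta>(1) jnf \<Theta>(2)]
    show "hankel_rank M (l - 1) \<Theta> + hankel_rank M (l + 1) \<Theta>
      = 2 * hankel_rank M l \<Theta> + jordan_block_count l \<Theta>"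
      unfolding r jordan_block_count_eq[OF jnf] using l by (induction n_as) auto
    show "hankel_rank M 0 \<Theta> = n"
      unfolding r jordan_nf_sum_sizes[OF \<Theta>(1) jnf, symmetric] by (induction n_as) auto
    show "hankel_rank M (n + 1) \<Theta> = 0"
      unfolding hankel_rank_eq_block_counts[OF \<Theta>] by simp
  qed
  show "\<forall>l\<in>{1..n}. jordan_block_count l \<Phi> = jordan_block_count l \<Psi>"
  proof
    fix l assume l: "l \<in> {1..n}"
    have all: "hankel_rank M k \<Phi> = hankel_rank M k \<Psi>" if k: "k \<le> n + 1" for k
    proof -
      consider "k = 0" | "k \<in> {1..n}" | "k = n + 1" using k by fastforce
      then show ?thesis using eq zero[OF \<Phi>, of 1] zero[OF \<Psi>, of 1] large[OF \<Phi>, of 1] large[OF \<Psi>, of 1]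
        by cases auto
    qed
    have "l - 1 \<le> n + 1" "l \<le> n + 1" "l + 1 \<le> n + 1" using l by auto
    then show "jordan_block_count l \<Phi> = jordan_block_count l \<Psi>"
      using diff[OF \<Phi>, of l] diff[OF \<Psi>, of l] all[of "l - 1"] all[of l] all[of "l + 1"] l by simp
  qed
qed

lemma scalar_mat_jordan_nf: "jordan_nf (c \<cdot>\<^sub>m 1\<^sub>m n) (replicate n (1, c :: complex))"
proof -
  have "jordan_matrix (replicate n (1, c)) = c \<cdot>\<^sub>m 1\<^sub>m n"
  proof (induction n)
    case 0
    show ?case unfolding jordan_matrix_def by (intro eq_matI) auto
  next
    case (Suc n)
    have s: "sum_list (map fst (replicate n (1::nat, c))) = n" by (induction n) auto
    show ?case
      unfolding replicate_Suc jordan_matrix_Cons s Suc by (intro eq_matI) (auto simp: jordan_block_def)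
  qed
  then show ?thesis
    unfolding jordan_nf_def using similar_mat_refl[of "c \<cdot>\<^sub>m 1\<^sub>m n" n] by auto
qed

lemma minor_cong:
  assumes "\<And>i. i < r \<Longrightarrow> f i = f' i" "\<And>i. i < r \<Longrightarrow> g i = g' i"
  shows "minor Q r f g = minor Q r f' g'"
  unfolding minor_def using assms by (intro arg_cong[where f = Determinant.det] eq_matI) auto

lemma nowhere_dense_in_diff:
  assumes op: "openin (top_of_set S) (S \<inter> G)"
    and dense: "\<And>W. open W \<Longrightarrow> W \<inter> S \<noteq> {} \<Longrightarrow> W \<inter> S \<inter> G \<noteq> {}"
  shows "nowhere_dense_in S (S - G)"
proof -
  have "closedin (top_of_set S) (S - G)"
    using closedin_diff[OF closedin_topspace op] by (simp add: Diff_Int)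
  then have cl: "(top_of_set S) closure_of (S - G) = S - G" by (simp add: closure_of_closedin)
  have "T = {}" if T: "openin (top_of_set S) T" "T \<subseteq> S - G" for T
  proof -
    from T(1) obtain W where W: "open W" "T = S \<inter> W" unfolding openin_open by blast
    then show ?thesis using dense[OF W(1)] T(2) by auto
  qed
  then have "(top_of_set S) interior_of (S - G) = {}"
    by (metis interior_of_subset openin_interior_of)
  then show ?thesis unfolding nowhere_dense_in_def cl by auto
qed

text \<open>The ring of these functions has no zero divisors: one factor is nonzero on a nonempty open set, and
the other one cannot vanish on all of it.\<close>

lemma regular_on_mult_nonzero:
  assumes X: "open X" "connected X" and f: "regular_on X f" and g: "regular_on X g"
    and x: "x \<in> closure X" "f x \<noteq> 0" and y: "y \<in> closure X" "g y \<noteq> 0"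
  shows "\<exists>z\<in>X. f z * g z \<noteq> 0"
proof -
  have "open UNIV" "UNIV \<inter> closure X \<noteq> {}" using x by auto
  from regular_on_nonzero_dense[OF X f x this] obtain a where a: "a \<in> X" "f a \<noteq> 0" .
  have "continuous_on X f"
    using f closure_subset continuous_on_subset unfolding regular_on_def by blast
  then have "open (X \<inter> f -` (- {0}))"
    by (rule continuous_open_preimage[OF _ X(1)]) auto
  moreover have "(X \<inter> f -` (- {0})) \<inter> closure X \<noteq> {}" using a closure_subset by auto
  ultimately obtain b where "b \<in> X \<inter> f -` (- {0})" "g b \<noteq> 0"
    using regular_on_nonzero_dense[OF X g y] by metis
  then show ?thesis by auto
qed

lemma regular_on_prod_nonzero:
  assumes X: "open X" "connected X" "X \<noteq> {}" and "finite I"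
    and f: "\<And>i. i \<in> I \<Longrightarrow> regular_on X (f i)"
    and x: "\<And>i. i \<in> I \<Longrightarrow> \<exists>x\<in>closure X. f i x \<noteq> 0"
  shows "\<exists>z\<in>X. (\<Prod>i\<in>I. f i z) \<noteq> 0"
  using assms(4) f x
proof (induction I)
  case empty
  then show ?case using X by auto
next
  case (insert i I)
  then obtain z where z: "z \<in> X" "(\<Prod>i\<in>I. f i z) \<noteq> 0" by auto
  obtain y where y: "y \<in> closure X" "f i y \<noteq> 0" using insert.prems by auto
  have "\<exists>z\<in>X. f i z * (\<Prod>i\<in>I. f i z) \<noteq> 0"
    by (rule regular_on_mult_nonzero[OF X(1,2), where f = "f i" and x = y and y = z])
      (use insert.prems y z closure_subset in \<open>auto intro: regular_on_prod\<close>)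
  then show ?case using insert.hyps by simp
qed

text \<open>Linear forms whose common zeros are the scalar matrices. They serve to raise the degree of an equation
to a prescribed value.\<close>

definition fill_entry :: "nat \<Rightarrow> nat \<Rightarrow> complex mat \<Rightarrow> complex" where
  "fill_entry a b \<Phi> = \<Phi> $$ (a, b) - (if a = b then \<Phi> $$ (0, 0) else 0)"

lemma fill_entry_zero_imp_scalar:
  assumes \<Phi>: "\<Phi> \<in> carrier_mat n n" and z: "\<And>a b. a < n \<Longrightarrow> b < n \<Longrightarrow> fill_entry a b \<Phi> = 0"
  shows "\<Phi> = \<Phi> $$ (0, 0) \<cdot>\<^sub>m 1\<^sub>m n"
proof (rule eq_matI)
  fix i j assume "i < dim_row (\<Phi> $$ (0, 0) \<cdot>\<^sub>m 1\<^sub>m n)" "j < dim_col (\<Phi> $$ (0, 0) \<cdot>\<^sub>m 1\<^sub>m n)"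
  then have ij: "i < n" "j < n" by auto
  from z[OF ij] have "\<Phi> $$ (i, j) = (if i = j then \<Phi> $$ (0, 0) else 0)"
    unfolding fill_entry_def by simp
  then show "\<Phi> $$ (i, j) = (\<Phi> $$ (0, 0) \<cdot>\<^sub>m 1\<^sub>m n) $$ (i, j)" using ij by simp
qed (use \<Phi> in auto)

lemma fill_entry_le:
  assumes \<Phi>: "\<Phi> \<in> carrier_mat n n" and ab: "a < n" "b < n"
  shows "cmod (fill_entry a b \<Phi>) \<le> 2 * mat_op_norm \<Phi>"
proof -
  have "cmod (fill_entry a b \<Phi>) \<le> cmod (\<Phi> $$ (a, b)) + cmod (if a = b then \<Phi> $$ (0, 0) else 0)"
    unfolding fill_entry_def by (rule norm_triangle_ineq4)
  also have "\<dots> \<le> mat_op_norm \<Phi> + mat_op_norm \<Phi>"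
    using mat_entry_le[OF \<Phi> ab] mat_entry_le[OF \<Phi>, of 0 0] mat_op_norm_nonneg[OF \<Phi>] ab
    by (intro add_mono) auto
  finally show ?thesis by simp
qed

locale jordan_family = regular_matrix X n A
  for X :: "(complex ^ 'N) set" and n :: nat and A :: "complex ^ 'N \<Rightarrow> complex mat" +
  assumes connected_X: "connected X" and X_nonempty: "X \<noteq> {}" and n_pos: "n \<ge> 1"
begin

definition max_ev :: nat where
  "max_ev = Max ((\<lambda>z. card (spectrum (A z))) ` closure X)"

definition max_split :: "(complex ^ 'N) set" where
  "max_split = {z \<in> closure X. card (spectrum (A z)) = max_ev}"

definition max_rank :: "nat \<Rightarrow> nat" where
  "max_rank k = Max ((\<lambda>z. hankel_rank max_ev k (A z)) ` max_split)"

definition generic :: "(complex ^ 'N) set" where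
  "generic = {z \<in> max_split. \<forall>k\<in>{1..n}. hankel_rank max_ev k (A z) = max_rank k}"

text \<open>Selections of rows (or columns) for all $k$ at once, made extensional outside the relevant range
so that there are only finitely many.\<close>

definition selections :: "(nat \<Rightarrow> nat \<Rightarrow> nat) set" where
  "selections = (\<Pi>\<^sub>E k\<in>{1..n}. \<Pi>\<^sub>E i\<in>{..<max_rank k}. {..<n})"

definition witness :: "(nat \<Rightarrow> nat \<Rightarrow> nat) \<Rightarrow> (nat \<Rightarrow> nat \<Rightarrow> nat) \<Rightarrow> complex mat \<Rightarrow> complex" where
  "witness F G \<Phi> = hankel_disc max_ev \<Phi>
     * (\<Prod>k\<in>{1..n}. minor (hankel_mat max_ev k \<Phi>) (max_rank k) (F k) (G k))"

lemma closure_nonempty: "closure X \<noteq> {}" using X_nonempty by simp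

lemma finite_card_image: "finite ((\<lambda>z. card (spectrum (A z))) ` closure X)"
  by (rule finite_subset[of _ "{..n}"]) (use card_finite_spectrum(2)[OF A_carrier] in auto)

lemma card_le_max_ev: "z \<in> closure X \<Longrightarrow> card (spectrum (A z)) \<le> max_ev"
  unfolding max_ev_def by (rule Max_ge[OF finite_card_image]) auto

lemma max_split_nonempty: "max_split \<noteq> {}"
proof -
  have "max_ev \<in> (\<lambda>z. card (spectrum (A z))) ` closure X"
    unfolding max_ev_def by (rule Max_in[OF finite_card_image]) (use closure_nonempty in auto)
  then show ?thesis unfolding max_split_def by auto
qed

lemma max_ev_le: "max_ev \<le> n"
  using max_split_nonempty card_finite_spectrum(2)[OF A_carrier] unfolding max_split_def by fastforce

lemma max_split_iff: "z \<in> max_split \<longleftrightarrow> z \<in> closure X \<and> hankel_disc max_ev (A z) \<noteq> 0"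
  using hankel_disc_nonzero_iff[OF A_carrier card_le_max_ev] unfolding max_split_def by blast

lemma max_split_closure: "z \<in> max_split \<Longrightarrow> z \<in> closure X" unfolding max_split_def by simp

lemma hankel_rank_le: "z \<in> closure X \<Longrightarrow> hankel_rank M k (A z) \<le> n"
  by (metis A_carrier carrier_matD(1) diff_le_self hankel_rank_def)

lemma finite_rank_image: "finite ((\<lambda>z. hankel_rank max_ev k (A z)) ` max_split)"
  by (rule finite_subset[of _ "{..n}"]) (use hankel_rank_le max_split_closure in auto)

lemma hankel_rank_le_max_rank: "z \<in> max_split \<Longrightarrow> hankel_rank max_ev k (A z) \<le> max_rank k"
  unfolding max_rank_def by (rule Max_ge[OF finite_rank_image]) auto

lemma max_rank_attained: obtains z where "z \<in> max_split" "hankel_rank max_ev k (A z) = max_rank k"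
proof -
  have "max_rank k \<in> (\<lambda>z. hankel_rank max_ev k (A z)) ` max_split"
    unfolding max_rank_def by (rule Max_in[OF finite_rank_image]) (use max_split_nonempty in auto)
  then show ?thesis using that by auto
qed

lemma max_rank_le: "max_rank k \<le> n"
  using max_rank_attained[of k] hankel_rank_le max_split_closure by metis

lemma finite_selections: "finite selections"
  unfolding selections_def by (intro finite_PiE) auto

lemma selections_lt: "F \<in> selections \<Longrightarrow> k \<in> {1..n} \<Longrightarrow> i < max_rank k \<Longrightarrow> F k i < n"
  unfolding selections_def by (auto dest!: PiE_mem)

lemma hankel_mat_carrier: "z \<in> closure X \<Longrightarrow> hankel_mat M k (A z) \<in> carrier_mat n n"
  unfolding hankel_mat_def by (rule poly_mat_carrier[OF A_carrier])

lemma selection_of_functions: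
  assumes "\<And>k. k \<in> {1..n} \<Longrightarrow> \<forall>i<max_rank k. f k i < n"
  obtains F where "F \<in> selections" "\<And>k i. k \<in> {1..n} \<Longrightarrow> i < max_rank k \<Longrightarrow> F k i = f k i"
proof (rule that[of "\<lambda>k\<in>{1..n}. \<lambda>i\<in>{..<max_rank k}. f k i"])
  show "(\<lambda>k\<in>{1..n}. \<lambda>i\<in>{..<max_rank k}. f k i) \<in> selections"
    unfolding selections_def using assms by (auto intro!: restrict_PiE_iff[THEN iffD2])
qed auto

text \<open>All ranks are at most the maximal ones, so they are attained as soon as some minors of
that size are nonzero.\<close>

lemma generic_iff_witness:
  assumes z: "z \<in> closure X"
  shows "z \<in> generic \<longleftrightarrow> (\<exists>F\<in>selections. \<exists>G\<in>selections. witness F G (A z) \<noteq> 0)"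
proof
  assume g: "z \<in> generic"
  then have zm: "z \<in> max_split" unfolding generic_def by simp
  have "\<exists>f g. (\<forall>i<max_rank k. f i < n) \<and> (\<forall>i<max_rank k. g i < n)
      \<and> minor (hankel_mat max_ev k (A z)) (max_rank k) f g \<noteq> 0" if k: "k \<in> {1..n}" for k
  proof -
    have "max_rank k = n - kernel_dim (hankel_mat max_ev k (A z))"
      using g k A_carrier[OF z] unfolding generic_def hankel_rank_def by auto
    from rank_minor_exists[OF hankel_mat_carrier[OF z] this] show ?thesis by metis
  qed
  then obtain f g where fg: "\<And>k. k \<in> {1..n} \<Longrightarrow> \<forall>i<max_rank k. f k i < n"
    "\<And>k. k \<in> {1..n} \<Longrightarrow> \<forall>i<max_rank k. g k i < n"
    "\<And>k. k \<in> {1..n} \<Longrightarrow> minor (hankel_mat max_ev k (A z)) (max_rank k) (f k) (g k) \<noteq> 0"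
    by metis
  obtain F where F: "F \<in> selections" "\<And>k i. k \<in> {1..n} \<Longrightarrow> i < max_rank k \<Longrightarrow> F k i = f k i"
    using selection_of_functions[OF fg(1)] by metis
  obtain G where G: "G \<in> selections" "\<And>k i. k \<in> {1..n} \<Longrightarrow> i < max_rank k \<Longrightarrow> G k i = g k i"
    using selection_of_functions[OF fg(2)] by metis
  have "minor (hankel_mat max_ev k (A z)) (max_rank k) (F k) (G k) \<noteq> 0" if "k \<in> {1..n}" for k
    using fg(3)[OF that] minor_cong[of "max_rank k" "F k" "f k" "G k" "g k"] F(2) G(2) that by metis
  then have "witness F G (A z) \<noteq> 0" using zm max_split_iff unfolding witness_def by auto
  then show "\<exists>F\<in>selections. \<exists>G\<in>selections. witness F G (A z) \<noteq> 0" using F(1) G(1) by blast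
next
  assume "\<exists>F\<in>selections. \<exists>G\<in>selections. witness F G (A z) \<noteq> 0"
  then obtain F G where FG: "F \<in> selections" "G \<in> selections" and w: "witness F G (A z) \<noteq> 0" by blast
  have zm: "z \<in> max_split" using w z max_split_iff unfolding witness_def by auto
  have "hankel_rank max_ev k (A z) = max_rank k" if k: "k \<in> {1..n}" for k
  proof (rule antisym[OF hankel_rank_le_max_rank[OF zm]])
    have "minor (hankel_mat max_ev k (A z)) (max_rank k) (F k) (G k) \<noteq> 0"
      using w k unfolding witness_def by auto
    from minor_size_le_rank[OF hankel_mat_carrier[OF z] _ _ this]
    show "max_rank k \<le> hankel_rank max_ev k (A z)"
      using selections_lt[OF FG(1) k] selections_lt[OF FG(2) k] A_carrier[OF z]
      unfolding hankel_rank_def by auto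
  qed
  then show "z \<in> generic" unfolding generic_def using zm by blast
qed

lemma regular_witness:
  assumes "F \<in> selections" "G \<in> selections"
  shows "regular_on X (\<lambda>z. witness F G (A z))"
  unfolding witness_def
  by (intro regular_on_mult regular_hankel_disc regular_on_prod regular_hankel_minor)
    (use assms selections_lt in auto)

text \<open>The maximal ranks for different $k$ may a priori be attained at different points; a common point exists
because a product of functions that are not identically zero is not identically zero.\<close>

lemma witness_not_identically_zero:
  obtains F G z where "F \<in> selections" "G \<in> selections" "z \<in> X" "witness F G (A z) \<noteq> 0"
proof -
  have "\<exists>f g. (\<forall>i<max_rank k. f i < n) \<and> (\<forall>i<max_rank k. g i < n)
      \<and> (\<exists>z\<in>closure X. minor (hankel_mat max_ev k (A z)) (max_rank k) f g \<noteq> 0)" for k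
  proof -
    obtain z where z: "z \<in> max_split" "hankel_rank max_ev k (A z) = max_rank k" by (rule max_rank_attained)
    then have "max_rank k = n - kernel_dim (hankel_mat max_ev k (A z))"
      using A_carrier[OF max_split_closure] unfolding hankel_rank_def by fastforce
    from rank_minor_exists[OF hankel_mat_carrier[OF max_split_closure[OF z(1)]] this]
    show ?thesis using max_split_closure[OF z(1)] by metis
  qed
  then obtain f g where fg: "\<And>k. \<forall>i<max_rank k. f k i < n" "\<And>k. \<forall>i<max_rank k. g k i < n"
    "\<And>k. \<exists>z\<in>closure X. minor (hankel_mat max_ev k (A z)) (max_rank k) (f k) (g k) \<noteq> 0"
    by metis
  obtain F where F: "F \<in> selections" "\<And>k i. k \<in> {1..n} \<Longrightarrow> i < max_rank k \<Longrightarrow> F k i = f k i"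
    using selection_of_functions[of f] fg(1) by metis
  obtain G where G: "G \<in> selections" "\<And>k i. k \<in> {1..n} \<Longrightarrow> i < max_rank k \<Longrightarrow> G k i = g k i"
    using selection_of_functions[of g] fg(2) by metis
  have nz: "\<exists>z\<in>closure X. minor (hankel_mat max_ev k (A z)) (max_rank k) (F k) (G k) \<noteq> 0"
    if "k \<in> {1..n}" for k
    using fg(3)[of k] minor_cong[of "max_rank k" "F k" "f k" "G k" "g k"] F(2) G(2) that by metis
  have reg: "regular_on X (\<lambda>z. minor (hankel_mat max_ev k (A z)) (max_rank k) (F k) (G k))"
    if "k \<in> {1..n}" for k
    by (intro regular_hankel_minor selections_lt that F G)
  obtain x where x: "x \<in> X"
    "(\<Prod>k\<in>{1..n}. minor (hankel_mat max_ev k (A x)) (max_rank k) (F k) (G k)) \<noteq> 0"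
    using regular_on_prod_nonzero[OF open_X connected_X X_nonempty, of "{1..n}"
      "\<lambda>k z. minor (hankel_mat max_ev k (A z)) (max_rank k) (F k) (G k)"] reg nz by auto
  obtain y where y: "y \<in> closure X" "hankel_disc max_ev (A y) \<noteq> 0"
    using max_split_nonempty max_split_iff by blast
  have "\<exists>z\<in>X. hankel_disc max_ev (A z)
      * (\<Prod>k\<in>{1..n}. minor (hankel_mat max_ev k (A z)) (max_rank k) (F k) (G k)) \<noteq> 0"
    by (rule regular_on_mult_nonzero[OF open_X connected_X regular_hankel_disc, where x = y and y = x])
      (use reg x y closure_subset in \<open>auto intro: regular_on_prod\<close>)
  then show ?thesis using that[OF F(1) G(1)] unfolding witness_def by blast
qed

lemma generic_subset: "generic \<subseteq> closure X"
  unfolding generic_def max_split_def by auto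

lemma generic_dense:
  assumes "open W" "W \<inter> closure X \<noteq> {}"
  obtains w where "w \<in> W" "w \<in> X" "w \<in> generic"
proof -
  obtain F G z where FG: "F \<in> selections" "G \<in> selections" and z: "z \<in> X" "witness F G (A z) \<noteq> 0"
    by (rule witness_not_identically_zero)
  have zc: "z \<in> closure X" using z(1) closure_subset by blast
  obtain w where w: "w \<in> W" "w \<in> X" "witness F G (A w) \<noteq> 0"
    using regular_on_nonzero_dense[OF open_X connected_X regular_witness[OF FG] zc z(2) assms] .
  moreover have "w \<in> closure X" using w(2) closure_subset by blast
  ultimately show ?thesis using that generic_iff_witness FG by blast
qed

lemma generic_open: "openin (top_of_set (closure X)) generic"
proof (subst openin_subopen, intro ballI)
  fix z assume z: "z \<in> generic"
  then have zc: "z \<in> closure X" using generic_subset by blast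
  obtain F G where FG: "F \<in> selections" "G \<in> selections" and w: "witness F G (A z) \<noteq> 0"
    using z generic_iff_witness[OF zc] by blast
  let ?T = "closure X \<inter> (\<lambda>z. witness F G (A z)) -` (- {0})"
  have "openin (top_of_set (closure X)) ?T"
    using regular_witness[OF FG] unfolding regular_on_def
    by (intro continuous_openin_preimage_gen) auto
  moreover have "z \<in> ?T" using zc w by simp
  moreover have "?T \<subseteq> generic" using generic_iff_witness FG by auto
  ultimately show "\<exists>T. openin (top_of_set (closure X)) T \<and> z \<in> T \<and> T \<subseteq> generic" by blast
qed

lemma generic_same_counts:
  assumes "z \<in> generic" "w \<in> generic" "l \<in> {1..n}"
  shows "jordan_block_count l (A z) = jordan_block_count l (A w)"
proof -
  have "\<forall>k\<in>{1..n}. hankel_rank max_ev k (A z) = hankel_rank max_ev k (A w)"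
    using assms unfolding generic_def by simp
  then show ?thesis
    using block_counts_eq_iff_hankel_ranks_eq[of "A z" n max_ev "A w"] assms A_carrier
    unfolding generic_def max_split_def by auto
qed

lemma generic_if_same_counts:
  assumes z: "z \<in> max_split" and w: "w \<in> generic"
    and eq: "\<And>l. l \<in> {1..n} \<Longrightarrow> jordan_block_count l (A z) = jordan_block_count l (A w)"
  shows "z \<in> generic"
proof -
  have "\<forall>k\<in>{1..n}. hankel_rank max_ev k (A z) = hankel_rank max_ev k (A w)"
    using block_counts_eq_iff_hankel_ranks_eq[of "A z" n max_ev "A w"] assms A_carrier
    unfolding generic_def max_split_def by auto
  then show ?thesis using z w unfolding generic_def by simp
qed

text \<open>A generic point is not a splitting point because it has the largest possible number of eigenvalues, and
its generic neighbours have the same ranks, thus the same block counts. For the converse a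
Jordan stable point is compared with a generic point nearby: not being a splitting point, it has at least as many
eigenvalues, and the block counts agree by stability.\<close>

theorem Jst_eq_generic: "Jst n X A = generic"
proof (intro equalityI subsetI)
  fix z assume z: "z \<in> generic"
  then have zc: "z \<in> closure X" using generic_subset by blast
  have "\<not> splitting_point X A z"
  proof
    assume "splitting_point X A z"
    moreover have "nbhd_in (closure X) z (closure X)"
      unfolding nbhd_in_def using zc by (intro conjI exI[of _ "closure X"]) auto
    ultimately obtain w where "w \<in> closure X" "card (spectrum (A w)) > card (spectrum (A z))"
      unfolding splitting_point_def by blast
    moreover have "card (spectrum (A z)) = max_ev" using z unfolding generic_def max_split_def by simp
    ultimately show False using card_le_max_ev[of w] by simp
  qed
  moreover have "nbhd_in (closure X) z generic"
    unfolding nbhd_in_def using generic_open generic_subset z by blast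
  moreover have "\<forall>l\<in>{1..n}. (\<lambda>w. jordan_block_count l (A w)) constant_on generic"
    unfolding constant_on_def using generic_same_counts[OF _ z] by blast
  ultimately show "z \<in> Jst n X A" unfolding Jst_def using zc by blast
next
  fix z assume "z \<in> Jst n X A"
  then obtain U V where zc: "z \<in> closure X" and U: "nbhd_in (closure X) z U"
    "\<And>w. w \<in> U \<Longrightarrow> card (spectrum (A w)) \<le> card (spectrum (A z))"
    and V: "nbhd_in (closure X) z V" "\<forall>l\<in>{1..n}. (\<lambda>w. jordan_block_count l (A w)) constant_on V"
    unfolding Jst_def splitting_point_def by (auto simp: not_less)
  \<comment> \<open>The two neighbourhoods, for the number of eigenvalues and for the block counts, are intersected.\<close>
  obtain S T where S: "open S" "z \<in> S" "closure X \<inter> S \<subseteq> U" and T: "open T" "z \<in> T" "closure X \<inter> T \<subseteq> V"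
    using U(1) V(1) unfolding nbhd_in_def openin_open by blast
  have "open (S \<inter> T)" "(S \<inter> T) \<inter> closure X \<noteq> {}" using S T zc by auto
  then obtain w where w: "w \<in> S \<inter> T" "w \<in> X" "w \<in> generic" by (rule generic_dense)
  have wU: "w \<in> U" and wV: "w \<in> V" and zV: "z \<in> V" using w S T generic_subset zc by auto
  have "max_ev \<le> card (spectrum (A z))"
    using U(2)[OF wU] w(3) unfolding generic_def max_split_def by simp
  then have zm: "z \<in> max_split" using card_le_max_ev[OF zc] zc unfolding max_split_def by simp
  show "z \<in> generic"
  proof (rule generic_if_same_counts[OF zm w(3)])
    fix l assume "l \<in> {1..n}"
    then show "jordan_block_count l (A z) = jordan_block_count l (A w)"
      using V(2) zV wV unfolding constant_on_def by metis
  qed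
qed

text \<open>At a scalar matrix there is one eigenvalue and $p(\<Phi>) = 0$. If the point is generic, then $M = 1$ and all
maximal ranks are zero, and every point meets these conditions.\<close>

lemma generic_if_scalar:
  assumes z: "z \<in> generic" and sc: "A z = c \<cdot>\<^sub>m 1\<^sub>m n"
  shows "generic = closure X"
proof -
  have zm: "z \<in> max_split" and zc: "z \<in> closure X" using z unfolding generic_def max_split_def by auto
  have jnf: "jordan_nf (A z) (replicate n (1, c))" unfolding sc by (rule scalar_mat_jordan_nf)
  have "spectrum (A z) = {c}"
    unfolding jordan_nf_spectrum[OF A_carrier[OF zc] jnf] using n_pos by auto
  then have M: "max_ev = 1" using zm unfolding max_split_def by simp
  have r: "max_rank k = 0" if k: "k \<in> {1..n}" for k
  proof -
    have "hankel_rank max_ev k (A z) = (\<Sum>(b, c)\<leftarrow>replicate n (1, c). b - k)"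
      using zm by (intro hankel_rank_jordan_nf[OF A_carrier[OF zc] jnf]) (simp add: max_split_def)
    also have "\<dots> = 0" using k by (simp add: sum_list_replicate)
    finally show ?thesis using z k unfolding generic_def by simp
  qed
  have "w \<in> generic" if w: "w \<in> closure X" for w
  proof -
    have "spectrum (A w) \<noteq> {}" using spectrum_non_empty[OF A_carrier[OF w]] n_pos by auto
    then have "card (spectrum (A w)) \<ge> 1"
      using card_finite_spectrum(1)[OF A_carrier[OF w]] by (simp add: Suc_le_eq card_gt_0_iff)
    then have "w \<in> max_split" using card_le_max_ev[OF w] w M unfolding max_split_def by simp
    moreover from this have "hankel_rank max_ev k (A w) = max_rank k" if "k \<in> {1..n}" for k
      using hankel_rank_le_max_rank[of w k] r[OF that] by simp
    ultimately show ?thesis unfolding generic_def by simp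
  qed
  then show ?thesis using generic_subset by blast
qed

definition witness_degree :: nat where
  "witness_degree = max_ev * (max_ev - 1)
     + (\<Sum>k\<in>{1..n}. max_rank k * (max_ev * (max_ev - 1) + k * max_ev))"

text \<open>The crude bounds $M \<le> n$, $r_k \<le> n$ and $k \<le> n$ give $n(n-1) + n (2 n^3 - n^2)$, which is below $2 n^4$.\<close>

lemma witness_degree_le: "witness_degree \<le> 2 * n ^ 4"
proof -
  have M: "max_ev * (max_ev - 1) \<le> n * (n - 1)" using max_ev_le by (intro mult_mono) auto
  have "(\<Sum>k\<in>{1..n}. max_rank k * (max_ev * (max_ev - 1) + k * max_ev))
      \<le> (\<Sum>k\<in>{1..n}. n * (n * (n - 1) + n * n))"
    by (intro sum_mono mult_mono add_mono M max_ev_le max_rank_le) auto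
  then have "witness_degree \<le> n * (n - 1) + n * (n * (n * (n - 1) + n * n))"
    unfolding witness_degree_def using M by simp
  also have "\<dots> \<le> 2 * n ^ 4"
  proof -
    obtain m where m: "n = Suc m" using n_pos by (cases n) auto
    show ?thesis unfolding m by (simp add: algebra_simps power_def eval_nat_numeral)
  qed
  finally show ?thesis .
qed

lemma witness_le:
  assumes z: "z \<in> closure X" and FG: "F \<in> selections" "G \<in> selections"
  shows "cmod (witness F G (A z)) \<le> real n ^ (2 * n ^ 4) * (2 * mat_op_norm (A z)) ^ witness_degree"
proof -
  let ?R = "2 * mat_op_norm (A z)" let ?e = "\<lambda>k. max_rank k * (max_ev * (max_ev - 1) + k * max_ev)"
  note C = A_carrier[OF z]
  have R: "?R \<ge> 0" using mat_op_norm_nonneg[OF C] by simp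
  have "(\<Prod>k\<in>{1..n}. cmod (minor (hankel_mat max_ev k (A z)) (max_rank k) (F k) (G k)))
      \<le> (\<Prod>k\<in>{1..n}. real n ^ (n + 2 * n ^ 2) * ?R ^ ?e k)"
    by (intro prod_mono conjI norm_ge_zero hankel_minor_le[OF C max_ev_le n_pos max_rank_le])
      (use selections_lt FG in auto)
  also have "\<dots> = real n ^ (n * (n + 2 * n ^ 2)) * ?R ^ (\<Sum>k\<in>{1..n}. ?e k)"
    by (simp add: prod.distrib power_sum power_mult[symmetric] mult.commute)
  finally have P: "(\<Prod>k\<in>{1..n}. cmod (minor (hankel_mat max_ev k (A z)) (max_rank k) (F k) (G k)))
      \<le> real n ^ (n * (n + 2 * n ^ 2)) * ?R ^ (\<Sum>k\<in>{1..n}. ?e k)" .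
  have "cmod (witness F G (A z)) \<le> (real n ^ (2 * n) * ?R ^ (max_ev * (max_ev - 1)))
      * (real n ^ (n * (n + 2 * n ^ 2)) * ?R ^ (\<Sum>k\<in>{1..n}. ?e k))"
    unfolding witness_def norm_mult prod_norm[symmetric]
    using hankel_disc_le[OF C max_ev_le n_pos] P R by (intro mult_mono) (auto intro: prod_nonneg)
  also have "\<dots> = real n ^ (2 * n + n * (n + 2 * n ^ 2)) * ?R ^ witness_degree"
    unfolding witness_degree_def by (simp only: power_add mult_ac)
  also have "\<dots> \<le> real n ^ (2 * n ^ 4) * ?R ^ witness_degree"
  proof (intro mult_right_mono)
    show "real n ^ (2 * n + n * (n + 2 * n ^ 2)) \<le> real n ^ (2 * n ^ 4)"
    \<comment> \<open>For n = 1 the inequality between the exponents fails, but then the base of the powers is 1.\<close>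
    proof (cases "n = 1")
      case False
      then have n2: "2 \<le> n" using n_pos by simp
      have "2 * n \<le> n ^ 2" "2 * n ^ 2 \<le> n ^ 3" "2 * n ^ 3 \<le> n ^ 4"
        using mult_right_mono[OF n2, of n] mult_right_mono[OF n2, of "n ^ 2"] mult_right_mono[OF n2, of "n ^ 3"]
        by (simp_all add: power2_eq_square power3_eq_cube eval_nat_numeral mult.assoc)
      moreover have "2 * n + n * (n + 2 * n ^ 2) = 2 * n + n ^ 2 + 2 * n ^ 3"
        by (simp add: power2_eq_square power3_eq_cube algebra_simps)
      ultimately have "2 * n + n * (n + 2 * n ^ 2) \<le> 2 * n ^ 4" by linarith
      then show ?thesis using n_pos by (intro power_increasing) auto
    qed simp
  qed (use R in simp)
  finally show ?thesis .
qed

text \<open>The exponent of the filling entry brings the total degree to exactly $2 n^4$.\<close>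

definition equation :: "(nat \<Rightarrow> nat \<Rightarrow> nat) \<times> (nat \<Rightarrow> nat \<Rightarrow> nat) \<times> nat \<times> nat \<Rightarrow> complex mat \<Rightarrow> complex" where
  "equation = (\<lambda>(F, G, a, b) \<Phi>. witness F G \<Phi> * fill_entry a b \<Phi> ^ (2 * n ^ 4 - witness_degree))"

lemma regular_equation:
  assumes "s \<in> selections \<times> selections \<times> {..<n} \<times> {..<n}"
  shows "regular_on X (\<lambda>z. equation s (A z))"
proof -
  obtain F G a b where s: "s = (F, G, a, b)" by (metis prod_cases4)
  have "regular_on X (\<lambda>z. if a = b then A z $$ (0, 0) else 0)"
    using n_pos by (cases "a = b") (auto intro: A_regular regular_on_const)
  then have "regular_on X (\<lambda>z. fill_entry a b (A z))"
    unfolding fill_entry_def using assms by (intro regular_on_diff A_regular) (auto simp: s)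
  then show ?thesis
    unfolding equation_def s using assms by (auto simp: s intro!: regular_on_mult regular_witness regular_on_power)
qed

lemma equation_le:
  assumes z: "z \<in> closure X" and s: "s \<in> selections \<times> selections \<times> {..<n} \<times> {..<n}"
  shows "cmod (equation s (A z)) \<le> real (2 * n) ^ (2 * n ^ 4) * mat_op_norm (A z) ^ (2 * n ^ 4)"
proof -
  obtain F G a b where sf: "s = (F, G, a, b)" by (metis prod_cases4)
  let ?R = "2 * mat_op_norm (A z)"
  note C = A_carrier[OF z]
  have R: "?R \<ge> 0" using mat_op_norm_nonneg[OF C] by simp
  have "cmod (equation s (A z))
      = cmod (witness F G (A z)) * cmod (fill_entry a b (A z)) ^ (2 * n ^ 4 - witness_degree)"
    unfolding equation_def sf by (simp add: norm_mult norm_power)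
  also have "\<dots> \<le> (real n ^ (2 * n ^ 4) * ?R ^ witness_degree) * ?R ^ (2 * n ^ 4 - witness_degree)"
    using witness_le[OF z, of F G] fill_entry_le[OF C, of a b] s R
    by (intro mult_mono power_mono) (auto simp: sf)
  also have "\<dots> = real n ^ (2 * n ^ 4) * ?R ^ (2 * n ^ 4)"
    unfolding mult.assoc power_add[symmetric] le_add_diff_inverse[OF witness_degree_le] ..
  finally show ?thesis by (simp add: power_mult_distrib mult_ac)
qed

lemma equation_zero_set:
  assumes z: "z \<in> closure X" and ne: "generic \<noteq> closure X"
  shows "z \<notin> generic \<longleftrightarrow> (\<forall>s\<in>selections \<times> selections \<times> {..<n} \<times> {..<n}. equation s (A z) = 0)"
proof
  assume "z \<notin> generic"
  then show "\<forall>s\<in>selections \<times> selections \<times> {..<n} \<times> {..<n}. equation s (A z) = 0"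
    using generic_iff_witness[OF z] unfolding equation_def by auto
next
  assume 0: "\<forall>s\<in>selections \<times> selections \<times> {..<n} \<times> {..<n}. equation s (A z) = 0"
  show "z \<notin> generic"
  proof
    assume g: "z \<in> generic"
    then obtain F G where FG: "F \<in> selections" "G \<in> selections" "witness F G (A z) \<noteq> 0"
      using generic_iff_witness[OF z] by blast
    have "fill_entry a b (A z) = 0" if "a < n" "b < n" for a b
      using 0 FG that unfolding equation_def by fastforce
    from fill_entry_zero_imp_scalar[OF A_carrier[OF z] this]
    have "generic = closure X" using generic_if_scalar[OF g] by blast
    with ne show False ..
  qed
qed

end

theorem theorem6p5:
  fixes X :: "(complex ^ 'N) set"
    and n :: nat
    and A :: "complex ^ 'N \<Rightarrow> complex mat"
  assumes "open X" and "connected X"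
    and "C0_smooth_boundary X"
    and "n \<ge> 1"
    and "\<And>\<zeta>. \<zeta> \<in> closure X \<Longrightarrow> A \<zeta> \<in> carrier_mat n n"
    and "mat_continuous_on n (closure X) A"
    and "mat_holomorphic_on n X A"
  shows "(nowhere_dense_in X (X - Jst n X A) \<and> analytic_subset X (X - Jst n X A)) \<and>
    nowhere_dense_in (closure X) (closure X - Jst n X A) \<and>
    (Jst n X A \<noteq> closure X \<longrightarrow>
      (\<exists>(l::nat) (h :: nat \<Rightarrow> complex ^ 'N \<Rightarrow> complex).
         (\<forall>j\<in>{1..l}. continuous_on (closure X) (h j) \<and> holomorphic_sev_on (h j) X) \<and>
         closure X - Jst n X A = {\<zeta> \<in> closure X. \<forall>j\<in>{1..l}. h j \<zeta> = 0} \<and>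
         (\<forall>\<zeta>\<in>closure X. \<forall>j\<in>{1..l}.
            cmod (h j \<zeta>) \<le> real (2 * n) ^ (2 * n ^ 4) * mat_op_norm (A \<zeta>) ^ (2 * n ^ 4))))"
proof (cases "X = {}")
  case True
  then show ?thesis
    by (auto simp: nowhere_dense_in_def analytic_subset_def Jst_def)
next
  case False
  interpret jordan_family X n A
    by unfold_locales
      (use assms False in \<open>auto simp: regular_on_def mat_continuous_on_def mat_holomorphic_on_def\<close>)
  have X_sub: "X \<subseteq> closure X" by (rule closure_subset)
  obtain T where T: "open T" "generic = closure X \<inter> T" using generic_open unfolding openin_open by blast
  have nd: "nowhere_dense_in X (X - generic)"
  proof (rule nowhere_dense_in_diff)
    show "openin (top_of_set X) (X \<inter> generic)" using T X_sub by (auto simp: openin_open)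
    fix W assume "open W" "W \<inter> X \<noteq> {}"
    then show "W \<inter> X \<inter> generic \<noteq> {}" using generic_dense[of W] X_sub by blast
  qed
  have nd': "nowhere_dense_in (closure X) (closure X - generic)"
  proof (rule nowhere_dense_in_diff)
    show "openin (top_of_set (closure X)) (closure X \<inter> generic)"
      using generic_open generic_subset by (simp add: Int_absorb1)
    fix W assume "open W" "W \<inter> closure X \<noteq> {}"
    then show "W \<inter> closure X \<inter> generic \<noteq> {}" using generic_dense[of W] X_sub by blast
  qed
  have an: "analytic_subset X (X - generic)"
  proof -
    have fin: "finite (selections \<times> selections)" using finite_selections by simp
    from ex_bij_betw_nat_finite[OF fin] obtain e
      where e: "bij_betw e {0..<card (selections \<times> selections)} (selections \<times> selections)" by auto
    let ?m = "card (selections \<times> selections)"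
    let ?f = "\<lambda>i z. witness (fst (e i)) (snd (e i)) (A z)"
    have ei: "fst (e i) \<in> selections" "snd (e i) \<in> selections" if "i < ?m" for i
      using e that by (auto simp: bij_betw_def dest!: equalityD1 subsetD[where c = "e i"])
    have hol: "\<forall>i<?m. holomorphic_sev_on (?f i) X"
      using regular_witness[OF ei] unfolding regular_on_def by blast
    have zs: "(X - generic) \<inter> X = {z \<in> X. \<forall>i<?m. ?f i z = 0}"
    proof -
      have "z \<in> generic \<longleftrightarrow> (\<exists>i<?m. ?f i z \<noteq> 0)" if zX: "z \<in> X" for z
      proof
        assume "z \<in> generic"
        then obtain F G where FG: "F \<in> selections" "G \<in> selections" "witness F G (A z) \<noteq> 0"
          using generic_iff_witness[of z] zX X_sub by blast
        then have "(F, G) \<in> e ` {0..<?m}" using bij_betw_imp_surj_on[OF e] by blast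
        then obtain i where i: "i \<in> {0..<?m}" "(F, G) = e i" by (rule imageE)
        from i(2)[symmetric] have "?f i z \<noteq> 0" using FG(3) by simp
        with i(1) show "\<exists>i<?m. ?f i z \<noteq> 0" by auto
      next
        assume "\<exists>i<?m. ?f i z \<noteq> 0"
        then show "z \<in> generic" using generic_iff_witness[of z] zX X_sub ei by blast
      qed
      then show ?thesis by auto
    qed
    have "\<exists>U. open U \<and> \<xi> \<in> U \<and> U \<subseteq> X \<and> (\<exists>(m::nat) f. (\<forall>i<m. holomorphic_sev_on (f i) U)
        \<and> (X - generic) \<inter> U = {z \<in> U. \<forall>i<m. f i z = 0})" if "\<xi> \<in> X" for \<xi>
      by (rule exI[of _ X], intro conjI open_X that order.refl, rule exI[of _ ?m], rule exI[of _ ?f],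
        rule conjI[OF hol zs])
    then show ?thesis unfolding analytic_subset_def by simp
  qed
  have eqs: "\<exists>(l::nat) (h :: nat \<Rightarrow> complex ^ 'N \<Rightarrow> complex).
         (\<forall>j\<in>{1..l}. continuous_on (closure X) (h j) \<and> holomorphic_sev_on (h j) X) \<and>
         closure X - generic = {\<zeta> \<in> closure X. \<forall>j\<in>{1..l}. h j \<zeta> = 0} \<and>
         (\<forall>\<zeta>\<in>closure X. \<forall>j\<in>{1..l}.
            cmod (h j \<zeta>) \<le> real (2 * n) ^ (2 * n ^ 4) * mat_op_norm (A \<zeta>) ^ (2 * n ^ 4))"
    if ne: "generic \<noteq> closure X"
  proof -
    define S where "S = selections \<times> selections \<times> {..<n} \<times> {..<n}"
    have fin: "finite S" unfolding S_def using finite_selections by simp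
    from ex_bij_betw_nat_finite_1[OF fin] obtain e where e: "bij_betw e {1..card S} S" by auto
    have surj: "e ` {1..card S} = S" by (rule bij_betw_imp_surj_on[OF e])
    have ei: "e j \<in> S" if "j \<in> {1..card S}" for j using imageI[OF that, of e] unfolding surj .
    have im: "(\<forall>s\<in>S. Q s) \<longleftrightarrow> (\<forall>j\<in>{1..card S}. Q (e j))" for Q
      by (subst surj[symmetric]) simp
    show ?thesis
    proof (intro exI[of _ "card S"] exI[of _ "\<lambda>j z. equation (e j) (A z)"] conjI ballI)
      fix j assume "j \<in> {1..card S}"
      from regular_equation[OF ei[OF this, unfolded S_def]]
      show "continuous_on (closure X) (\<lambda>z. equation (e j) (A z))"
        "holomorphic_sev_on (\<lambda>z. equation (e j) (A z)) X" unfolding regular_on_def by auto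
    next
      have "z \<notin> generic \<longleftrightarrow> (\<forall>j\<in>{1..card S}. equation (e j) (A z) = 0)" if "z \<in> closure X" for z
        using equation_zero_set[OF that ne] unfolding S_def[symmetric] im .
      then show "closure X - generic = {\<zeta> \<in> closure X. \<forall>j\<in>{1..card S}. equation (e j) (A \<zeta>) = 0}"
        by blast
    next
      fix \<zeta> j assume "\<zeta> \<in> closure X" "j \<in> {1..card S}"
      from equation_le[OF this(1) ei[OF this(2), unfolded S_def]]
      show "cmod (equation (e j) (A \<zeta>))
          \<le> real (2 * n) ^ (2 * n ^ 4) * mat_op_norm (A \<zeta>) ^ (2 * n ^ 4)" .
    qed
  qed
  show ?thesis unfolding Jst_eq_generic by (intro conjI impI nd nd' an eqs)
qed

end
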